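(* For $|q|<1$, $$\sum_{\lambda\in\mathcal{P}'_4}(-1)^{o(\lambda)}q^{|\lambda|}=\sum_{n=0}^{\infty}\frac{(q;q^2)_{n}(-1)^nq^{n^2+2n}}{(q^4;q^4)_{n}}=\frac{(q^3,q^9;q^{12})_{\infty}}{(q^4,q^8;q^{12})_{\infty}},$$ where $\mathcal P'_4$ is the set of strict partitions with mod-$4$ gap conditions defined in the context and $o(\lambda)$ is the number of odd parts of $\lambda$.
   Context: For $n\in\mathbb Z_{\ge 0}\cup\{\infty\}$, $(a;q)_n:=\prod_{j=0}^{n-1}(1-aq^j)$ and $(a_1,\ldots,a_r;q)_n:=\prod_{j=1}^r(a_j;q)_n$ (and similarly with base $q$ replaced by a power of $q$). A partition is a finite non-increasing sequence $\lambda=(\lambda_1,\lambda_2,\ldots,\lambda_k)$ of positive integers (the empty partition is allowed); it is strict if its parts are distinct. $|\lambda|$ is the sum of the parts. $\mathcal P'_4$ is the set of strict partitions $\lambda$ such that, for each pair of consecutive parts $\lambda_i,\lambda_{i+1}$: (1) $\lambda_i-\lambda_{i+1}\equiv 2\pmod 4$ if both are odd; (2) $\lambda_i-\lambda_{i+1}\equiv 0\pmod 4$ if both are even; (3) $\lambda_i-\lambda_{i+1}\equiv 3\pmod 4$ if they have different parity; and (4) the smallest part of $\lambda$ is congruent to $3$ or $0$ modulo $4$. The empty partition belongs to $\mathcal P'_4$. *)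

theory Defs
  imports "HOL-Analysis.Analysis" "HOL-Library.Extended_Nat"
begin

(* The infinite case is the library infinite product, which converges for
   norm q < 1; there a vanishing factor makes the value 0.  Note 0 ^ 0 = 1, so
   the factor at j = 0 is 1 - a also for q = 0. *)
definition qpoch :: "complex \<Rightarrow> complex \<Rightarrow> enat \<Rightarrow> complex" where
  "qpoch a q N = (case N of enat n \<Rightarrow> (\<Prod>j<n. 1 - a * q ^ j) | \<infinity> \<Rightarrow> (\<Prod>j. 1 - a * q ^ j))"

definition qpochs :: "complex list \<Rightarrow> complex \<Rightarrow> enat \<Rightarrow> complex" where
  "qpochs as q N = (\<Prod>a\<leftarrow>as. qpoch a q N)"

definition is_partition :: "nat list \<Rightarrow> bool" where
  "is_partition p \<longleftrightarrow> sorted_wrt (\<ge>) p \<and> (\<forall>x\<in>set p. 0 < x)"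

definition is_strict_partition :: "nat list \<Rightarrow> bool" where
  "is_strict_partition p \<longleftrightarrow> is_partition p \<and> distinct p"

definition num_odd_parts :: "nat list \<Rightarrow> nat" where
  "num_odd_parts p = length (filter odd p)"

(* The parts are weakly decreasing, so the natural-number difference of
   consecutive parts is not truncated, and the smallest part is the last one. *)
definition P4' :: "nat list set" where
  "P4' = {p. is_strict_partition p \<and>
     (\<forall>i. Suc i < length p \<longrightarrow>
        (odd (p ! i) \<and> odd (p ! Suc i) \<longrightarrow> (p ! i - p ! Suc i) mod 4 = 2) \<and>
        (even (p ! i) \<and> even (p ! Suc i) \<longrightarrow> (p ! i - p ! Suc i) mod 4 = 0) \<and>
        (even (p ! i) \<noteq> even (p ! Suc i) \<longrightarrow> (p ! i - p ! Suc i) mod 4 = 3)) \<and>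
     (p \<noteq> [] \<longrightarrow> last p mod 4 = 3 \<or> last p mod 4 = 0)}"

end

theory Submission
  imports Defs
begin

text \<open>
  Removing the smallest part \<open>3 + e + 4k\<close> (with \<open>e = 0\<close> or \<open>e = 1\<close> according to its parity) of a
  partition in \<open>\<P>'\<^sub>4\<close> and lowering all other parts by \<open>2 (1 + e + 2k)\<close> gives an
  arbitrary element of \<open>\<P>'\<^sub>4\<close> with one part less. So passing from \<open>n\<close> to \<open>n + 1\<close> parts multiplies the
  signed generating function by \<open>(- q^(2n+3) + q^(4n+4)) / (1 - q^(4n+4))\<close>, which gives the series.

  For the product, Slater's Bailey pair E(3) in base \<open>q\<^sup>2\<close> expands \<open>1 / (q\<^sup>4; q\<^sup>4)_n\<close> as a sum
  over \<open>r \<le> n\<close>. After interchanging the summations, the sum over \<open>n\<close> is evaluated by the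
  \<open>1\<phi>1\<close> summation formula, which leaves \<open>(q; q\<^sup>2)_\<infinity> / (q\<^sup>2; q\<^sup>2)_\<infinity>\<close> times the bilateral theta series
  of \<open>q^(3r\<^sup>2+2r)\<close>. The Jacobi triple product turns the latter into a product, and the two
  product forms agree by dissection.
\<close>

section \<open>Infinite q-Pochhammer symbols\<close>

abbreviation qpn :: "complex \<Rightarrow> complex \<Rightarrow> nat \<Rightarrow> complex" where
  "qpn a q n \<equiv> qpoch a q (enat n)"

lemma qpoch_0 [simp]: "qpn a q 0 = 1"
  by (simp add: qpoch_def)

lemma qpoch_Suc: "qpn a q (Suc n) = qpn a q n * (1 - a * q ^ n)"
  by (simp add: qpoch_def)

lemma qpoch_add: "qpn a q (m + n) = qpn a q m * qpn (a * q ^ m) q n"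
  by (induction n) (simp_all add: qpoch_Suc power_add mult_ac)

lemma qpoch_Suc_shift: "qpn a q (Suc n) = (1 - a) * qpn (a * q) q n"
  using qpoch_add[of a q 1 n] by (simp add: qpoch_Suc[of _ _ 0, simplified])

lemma qpoch_finite_eq_0_iff: "qpn a q n = 0 \<longleftrightarrow> (\<exists>j<n. a * q ^ j = 1)"
  by (auto simp: qpoch_def)

lemma qpoch_convergent_prod:
  fixes a q :: complex
  assumes "norm q < 1"
  shows "convergent_prod (\<lambda>j. 1 - a * q ^ j)"
proof (rule abs_convergent_prod_imp_convergent_prod, rule summable_imp_abs_convergent_prod)
  have "summable (\<lambda>j. norm a * norm q ^ j)"
    using assms by (intro summable_mult summable_geometric) simp
  then show "summable (\<lambda>j. norm (1 - a * q ^ j - 1))"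
    by (simp add: norm_mult norm_power)
qed

lemma qpoch_tendsto:
  assumes "norm q < 1"
  shows "qpn a q \<longlonglongrightarrow> qpoch a q \<infinity>"
  using convergent_prod_LIMSEQ[OF qpoch_convergent_prod[OF assms, of a]]
  by (subst (asm) LIMSEQ_lessThan_iff_atMost[symmetric]) (simp add: qpoch_def)

lemma qpoch_infinite_nonzero:
  assumes "norm q < 1" "\<And>j. a * q ^ j \<noteq> 1"
  shows "qpoch a q \<infinity> \<noteq> 0"
  using prodinf_nonzero[OF qpoch_convergent_prod[OF assms(1), of a]] assms(2)
  by (simp add: qpoch_def)

lemma mult_power_neq_1:
  fixes a q :: complex
  assumes "norm a < 1" "norm q < 1"
  shows "a * q ^ j \<noteq> 1"
proof
  assume *: "a * q ^ j = 1"
  have "norm (a * q ^ j) \<le> norm a * 1"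
    unfolding norm_mult norm_power using assms by (intro mult_left_mono power_le_one) auto
  then show False using * assms by simp
qed

lemma qpoch_finite_nonzero:
  assumes "norm a < 1" "norm q < 1"
  shows "qpn a q n \<noteq> 0"
  using mult_power_neq_1[OF assms] by (simp add: qpoch_finite_eq_0_iff)

lemma qpoch_infinite_nonzero_unit_disc:
  assumes "norm a < 1" "norm q < 1"
  shows "qpoch a q \<infinity> \<noteq> 0"
  by (rule qpoch_infinite_nonzero) (use assms mult_power_neq_1 in auto)

lemma qpoch_infinite_split:
  assumes "norm q < 1"
  shows "qpoch a q \<infinity> = qpn a q m * qpoch (a * q ^ m) q \<infinity>"
proof (rule LIMSEQ_unique)
  show "(\<lambda>n. qpn a q (m + n)) \<longlonglongrightarrow> qpoch a q \<infinity>"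
    using LIMSEQ_ignore_initial_segment[OF qpoch_tendsto[OF assms, of a], of m]
    by (simp add: add.commute)
  show "(\<lambda>n. qpn a q (m + n)) \<longlonglongrightarrow> qpn a q m * qpoch (a * q ^ m) q \<infinity>"
    unfolding qpoch_add by (intro tendsto_intros qpoch_tendsto assms)
qed

lemma qpoch_bounded:
  assumes "norm q < 1"
  shows "\<exists>B>0. \<forall>n. norm (qpn a q n) \<le> B"
  using convergent_imp_Bseq[OF convergentI[OF qpoch_tendsto[OF assms, of a]]]
  by (auto elim: BseqE)

text \<open>No factor vanishes, so the infinite product is nonzero and the reciprocals converge to
  its inverse.\<close>

lemma inverse_qpoch_bounded:
  assumes "norm q < 1" "\<And>j. a * q ^ j \<noteq> 1"
  shows "\<exists>B>0. \<forall>n. norm (inverse (qpn a q n)) \<le> B"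
  using convergent_imp_Bseq[OF convergentI[OF tendsto_inverse[OF qpoch_tendsto[OF assms(1), of a]
    qpoch_infinite_nonzero[OF assms]]]]
  by (auto elim: BseqE)

lemma qpoch_infinite_dissect:
  assumes "norm q < 1" "m > 0"
  shows "qpoch a q \<infinity> = (\<Prod>i<m. qpoch (a * q ^ i) (q ^ m) \<infinity>)"
proof (rule LIMSEQ_unique)
  have "norm (q ^ m) < 1"
    using assms by (simp add: norm_power power_less_one_iff)
  then show "(\<lambda>n. \<Prod>i<m. qpn (a * q ^ i) (q ^ m) n) \<longlonglongrightarrow> (\<Prod>i<m. qpoch (a * q ^ i) (q ^ m) \<infinity>)"
    by (intro tendsto_prod qpoch_tendsto)
  \<comment> \<open>The first \<open>n * m\<close> factors are grouped by the residue of their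
    exponent modulo \<open>m\<close>.\<close>
  have "(\<Prod>i<m. qpn (a * q ^ i) (q ^ m) n) = qpn a q (n * m)" for n
  proof -
    have "qpn a q (n * m) = (\<Prod>k<n. \<Prod>j\<in>{k * m..<k * m + m}. 1 - a * q ^ j)"
      by (simp add: qpoch_def prod.nat_group)
    also have "\<dots> = (\<Prod>k<n. \<Prod>i<m. 1 - a * q ^ (i + k * m))"
      using prod.shift_bounds_nat_ivl[of "\<lambda>j. 1 - a * q ^ j" 0 "_ * m" m]
      by (simp add: atLeast0LessThan add.commute)
    also have "\<dots> = (\<Prod>i<m. qpn (a * q ^ i) (q ^ m) n)"
      by (subst prod.swap) (simp add: qpoch_def power_add power_mult mult_ac flip: power_mult)
    finally show ?thesis by simp
  qed
  moreover have "filterlim (\<lambda>n. n * m) at_top sequentially"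
    using assms by (intro filterlim_subseq) (simp add: strict_mono_def)
  ultimately show "(\<lambda>n. \<Prod>i<m. qpn (a * q ^ i) (q ^ m) n) \<longlonglongrightarrow> qpoch a q \<infinity>"
    using filterlim_compose[OF qpoch_tendsto[OF assms(1), of a]] by simp
qed

lemma qpoch_infinite_mult_minus:
  assumes "norm q < 1"
  shows "qpoch a q \<infinity> * qpoch (- a) q \<infinity> = qpoch (a\<^sup>2) (q\<^sup>2) \<infinity>"
proof (rule LIMSEQ_unique)
  show "(\<lambda>n. qpn a q n * qpn (- a) q n) \<longlonglongrightarrow> qpoch a q \<infinity> * qpoch (- a) q \<infinity>"
    by (intro tendsto_intros qpoch_tendsto assms)
  have "qpn a q n * qpn (- a) q n = qpn (a\<^sup>2) (q\<^sup>2) n" for n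
    by (induction n) (simp_all add: qpoch_Suc power2_eq_square power_mult_distrib algebra_simps)
  moreover have "norm (q\<^sup>2) < 1"
    using assms by (simp add: norm_power power_less_one_iff)
  ultimately show "(\<lambda>n. qpn a q n * qpn (- a) q n) \<longlonglongrightarrow> qpoch (a\<^sup>2) (q\<^sup>2) \<infinity>"
    by (simp add: qpoch_tendsto)
qed

section \<open>Dominated convergence for series (Tannery) and the majorant
  \<open>c ^ m * x ^ (m choose 2)\<close>\<close>

lemma tannery:
  fixes f :: "nat \<Rightarrow> nat \<Rightarrow> complex"
  assumes "\<And>m. (\<lambda>n. f n m) \<longlonglongrightarrow> g m"
    and "summable w" and "\<And>n m. norm (f n m) \<le> w m"
  shows "(\<lambda>n. \<Sum>m. f n m) \<longlonglongrightarrow> (\<Sum>m. g m)"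
proof -
  \<comment> \<open>As a bound on norms \<open>w\<close> is nonnegative, so its summability is
    integrability for the counting measure.\<close>
  have w: "integrable (count_space UNIV) w"
    unfolding integrable_count_space_nat_iff
  proof (rule summable_comparison_test'[OF assms(2)])
    show "norm (norm (w n)) \<le> w n" for n
      using order_trans[OF norm_ge_zero assms(3)] by simp
  qed
  note dom = assms(1) w assms(3)
  have g: "integrable (count_space UNIV) g"
    by (rule integrable_dominated_convergence[where s = f and w = w]) (use dom in auto)
  have f: "integrable (count_space UNIV) (f n)" for n
    by (rule integrable_dominated_convergence2[where f = g and w = w]) (use dom in auto)
  have "(\<lambda>n. integral\<^sup>L (count_space UNIV) (f n)) \<longlonglongrightarrow> integral\<^sup>L (count_space UNIV) g"
    by (rule integral_dominated_convergence[where w = w]) (use dom in auto)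
  then show "(\<lambda>n. \<Sum>m. f n m) \<longlonglongrightarrow> (\<Sum>m. g m)"
    by (simp add: integral_count_space_nat[OF f] integral_count_space_nat[OF g])
qed

lemma choose_2_Suc: "Suc m choose 2 = m + (m choose 2)"
  by (simp add: numeral_2_eq_2)

text \<open>Consecutive terms differ by the factor \<open>c * x ^ m\<close>, which tends to 0. This
  majorant serves both the \<open>1\<phi>1\<close> series and the theta series.\<close>

lemma summable_power_choose_2:
  fixes c x :: real
  assumes "0 \<le> x" "x < 1" "0 \<le> c"
  shows "summable (\<lambda>m. c ^ m * x ^ (m choose 2))"
proof -
  have "(\<lambda>m. c * x ^ m) \<longlonglongrightarrow> c * 0"
    using assms by (intro tendsto_intros LIMSEQ_power_zero) auto
  then have "eventually (\<lambda>m. c * x ^ m < 1 / 2) sequentially"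
    by (intro order_tendstoD) auto
  then obtain N where N: "\<And>m. m \<ge> N \<Longrightarrow> c * x ^ m < 1 / 2"
    by (auto simp: eventually_sequentially)
  show ?thesis
  proof (rule summable_ratio_test[where c = "1 / 2" and N = N])
    fix m assume "m \<ge> N"
    then have "(c * x ^ m) * (c ^ m * x ^ (m choose 2)) \<le> 1 / 2 * (c ^ m * x ^ (m choose 2))"
      using N[of m] assms by (intro mult_right_mono) auto
    then show "norm (c ^ Suc m * x ^ (Suc m choose 2)) \<le> 1 / 2 * norm (c ^ m * x ^ (m choose 2))"
      using assms by (simp add: choose_2_Suc power_add mult_ac)
  qed simp
qed

section \<open>The \<open>1\<phi>1\<close> summation\<close>

text \<open>General term of the series \<open>1\<phi>1(a; c; q, z)\<close> at
  \<open>c = a z\<close>; keeping \<open>z\<close> as the parameter avoids the quotient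
  \<open>c / a\<close> of the usual formulation.\<close>

definition phi11_term :: "complex \<Rightarrow> complex \<Rightarrow> complex \<Rightarrow> nat \<Rightarrow> complex" where
  "phi11_term q a z m = qpn a q m * (-1) ^ m * q ^ (m choose 2) * z ^ m / (qpn q q m * qpn (a * z) q m)"

text \<open>The bound is uniform in \<open>n\<close>, so that dominated convergence applies as
  \<open>z * q ^ n\<close> tends to 0.\<close>

lemma phi11_bound:
  assumes q: "norm q < 1" and az: "\<And>j. a * z * q ^ j \<noteq> 1"
  shows "\<exists>C>0. \<forall>n m. norm (phi11_term q a (z * q ^ n) m) \<le> C * (norm z ^ m * norm q ^ (m choose 2))"
proof -
  obtain A where A: "A > 0" "\<And>n. norm (qpn a q n) \<le> A"
    using qpoch_bounded[OF q] by blast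
  obtain B where B: "B > 0" "\<And>n. norm (inverse (qpn q q n)) \<le> B"
    using inverse_qpoch_bounded[OF q, of q] mult_power_neq_1[OF q q] by blast
  obtain D where D: "D > 0" "\<And>n. norm (inverse (qpn (a * z) q n)) \<le> D"
    using inverse_qpoch_bounded[OF q az] by blast
  obtain E where E: "E > 0" "\<And>n. norm (qpn (a * z) q n) \<le> E"
    using qpoch_bounded[OF q] by blast
  have "norm (phi11_term q a (z * q ^ n) m) \<le> A * B * (E * D) * (norm z ^ m * norm q ^ (m choose 2))" for n m
  proof -
    have nz: "qpn (a * z) q k \<noteq> 0" for k
      using az by (simp add: qpoch_finite_eq_0_iff)
    \<comment> \<open>The denominator depends on \<open>n\<close>; as a quotient of two symbols
      based at \<open>a * z\<close> it is controlled by the constants \<open>E\<close> and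
      \<open>D\<close>.\<close>
    have inv: "inverse (qpn (a * (z * q ^ n)) q m) = qpn (a * z) q n * inverse (qpn (a * z) q (n + m))"
      using nz[of n] by (simp add: qpoch_add mult.assoc divide_simps)
    define X where "X = (-1) ^ m * q ^ (m choose 2) * z ^ m * (q ^ n) ^ m"
    have eq: "phi11_term q a (z * q ^ n) m
        = (qpn a q m * inverse (qpn q q m)) * (qpn (a * z) q n * inverse (qpn (a * z) q (n + m))) * X"
      using inv by (simp add: phi11_term_def X_def divide_inverse power_mult_distrib mult_ac)
    have "norm (q ^ n) ^ m \<le> 1"
      using q by (simp add: norm_power power_le_one)
    then have "norm z ^ m * norm q ^ (m choose 2) * norm (q ^ n) ^ m \<le> norm z ^ m * norm q ^ (m choose 2) * 1"
      by (intro mult_left_mono) auto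
    moreover have "norm X = norm z ^ m * norm q ^ (m choose 2) * norm (q ^ n) ^ m"
      unfolding X_def
      by (simp only: norm_mult norm_power norm_minus_cancel norm_one power_one mult_ac mult_1_left)
    ultimately have "norm X \<le> norm z ^ m * norm q ^ (m choose 2)"
      by simp
    then show ?thesis
      unfolding eq norm_mult using A B D E
      by (intro mult_mono) auto
  qed
  moreover have "A * B * (E * D) > 0"
    using A B D E by simp
  ultimately show ?thesis by blast
qed

lemma phi11_summable:
  assumes q: "norm q < 1" and az: "\<And>j. a * z * q ^ j \<noteq> 1"
  shows "summable (\<lambda>m. norm (phi11_term q a z m))"
proof -
  obtain C where "C > 0" "\<And>n m. norm (phi11_term q a (z * q ^ n) m) \<le> C * (norm z ^ m * norm q ^ (m choose 2))"
    using phi11_bound[OF assms] by blast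
  from this(2)[of 0] show ?thesis
    by (intro summable_comparison_test'[OF summable_mult[OF summable_power_choose_2[of "norm q" "norm z"]], of 0 _ C])
       (use q in auto)
qed

text \<open>
  Wilf-Zeilberger certificate for \<open>(1 - az) f(z) = (1 - z) f(qz)\<close>; iterating this relation reduces
  the sum to its value at \<open>z = 0\<close>.
\<close>

lemma phi11_telescope:
  assumes q: "norm q < 1" and az: "\<And>j. a * z * q ^ j \<noteq> 1"
  defines "G \<equiv> \<lambda>m. - phi11_term q a z m * (1 - a * z) * (1 - q ^ m)"
  shows "(1 - a * z) * phi11_term q a z m - (1 - z) * phi11_term q a (z * q) m = G (Suc m) - G m"
proof -
  define N where "N = qpn a q m * (-1) ^ m * q ^ (m choose 2) * z ^ m"
  define P where "P = qpn q q m"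
  define R where "R = qpn (a * z * q) q m"
  define x where "x = q ^ m"
  have P: "P \<noteq> 0" unfolding P_def using qpoch_finite_nonzero q by blast
  have az0: "1 - a * z \<noteq> 0" using az[of 0] by simp
  have azm: "1 - a * z * x \<noteq> 0" using az[of m] by (simp add: x_def)
  have nz: "qpn (a * z) q k \<noteq> 0" for k
    using az by (simp add: qpoch_finite_eq_0_iff)
  have R: "R \<noteq> 0"
    using nz[of "Suc m"] by (simp add: R_def qpoch_Suc_shift)
  have qm: "1 - q * x \<noteq> 0"
    using mult_power_neq_1[OF q q, of m] by (simp add: x_def)
  have azR: "qpn (a * z) q (Suc m) = (1 - a * z) * R"
    by (simp add: qpoch_Suc_shift R_def)
  then have azR': "qpn (a * z) q m = (1 - a * z) * R / (1 - a * z * x)"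
    using azm by (simp add: qpoch_Suc x_def field_simps)
  have t0: "phi11_term q a z m = N * (1 - a * z * x) / (P * ((1 - a * z) * R))"
    by (simp add: phi11_term_def N_def[symmetric] P_def[symmetric] azR')
  have t1: "phi11_term q a (z * q) m = N * x / (P * R)"
    unfolding phi11_term_def N_def P_def R_def x_def
    by (simp add: power_mult_distrib mult_ac)
  have t2: "phi11_term q a z (Suc m) = - N * (1 - a * x) * x * z / (P * (1 - q * x) * ((1 - a * z) * R))"
    unfolding phi11_term_def azR unfolding N_def P_def x_def
    by (simp add: qpoch_Suc choose_2_Suc power_add mult_ac)
  have "G (Suc m) - G m = N / (P * R) * ((1 - a * x) * x * z + (1 - a * z * x) * (1 - x))"
    using P az0 R qm unfolding G_def t0 t2 by (simp add: divide_simps x_def[symmetric]) (simp add: algebra_simps)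
  \<comment> \<open>With the common factor taken out, the certificate is a polynomial identity in
    \<open>a\<close>, \<open>z\<close> and \<open>x = q ^ m\<close>.\<close>
  also have "\<dots> = N / (P * R) * ((1 - a * z * x) - (1 - z) * x)"
    by (simp add: algebra_simps)
  also have "\<dots> = (1 - a * z) * phi11_term q a z m - (1 - z) * phi11_term q a (z * q) m"
    using P az0 R unfolding t0 t1 by (simp add: divide_simps) (simp add: algebra_simps)
  finally show ?thesis by simp
qed

lemma phi11_shift:
  assumes q: "norm q < 1" and az: "\<And>j. a * z * q ^ j \<noteq> 1"
  shows "(1 - a * z) * (\<Sum>m. phi11_term q a z m) = (1 - z) * (\<Sum>m. phi11_term q a (z * q) m)"
proof -
  have az': "a * (z * q) * q ^ j \<noteq> 1" for j
    using az[of "Suc j"] by (simp add: mult_ac)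
  have s: "summable (phi11_term q a z)" "summable (phi11_term q a (z * q))"
    using phi11_summable[OF q az] phi11_summable[OF q az'] by (auto intro: summable_norm_cancel)
  define G where "G = (\<lambda>m. - phi11_term q a z m * (1 - a * z) * (1 - q ^ m))"
  \<comment> \<open>Both boundary terms vanish: \<open>G 0\<close> because of the factor
    \<open>1 - q ^ 0\<close>, the limit because the terms of a convergent series tend to 0.\<close>
  have "G \<longlonglongrightarrow> - 0 * (1 - a * z) * (1 - 0)"
    unfolding G_def by (intro tendsto_intros summable_LIMSEQ_zero s LIMSEQ_power_zero q)
  then have "(\<lambda>m. G (Suc m) - G m) sums (0 - G 0)"
    by (intro telescope_sums) simp
  then have "(\<lambda>m. (1 - a * z) * phi11_term q a z m - (1 - z) * phi11_term q a (z * q) m) sums 0"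
    using phi11_telescope[OF q az] by (simp add: G_def)
  moreover have "(\<lambda>m. (1 - a * z) * phi11_term q a z m - (1 - z) * phi11_term q a (z * q) m) sums
      ((1 - a * z) * (\<Sum>m. phi11_term q a z m) - (1 - z) * (\<Sum>m. phi11_term q a (z * q) m))"
    by (intro sums_diff sums_mult summable_sums s)
  ultimately show ?thesis
    using sums_unique2 by fastforce
qed

theorem phi11_sum:
  assumes q: "norm q < 1" and az: "\<And>j. a * z * q ^ j \<noteq> 1"
  shows "phi11_term q a z sums (qpoch z q \<infinity> / qpoch (a * z) q \<infinity>)"
proof -
  define f where "f = (\<lambda>z. \<Sum>m. phi11_term q a z m)"
  have az': "a * (z * q ^ n) * q ^ j \<noteq> 1" for n j
    using az[of "n + j"] by (simp add: mult_ac power_add)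
  have nz: "qpn (a * z) q k \<noteq> 0" for k
    using az by (simp add: qpoch_finite_eq_0_iff)
  have iter: "qpn (a * z) q n * f z = qpn z q n * f (z * q ^ n)" for n
  proof (induction n)
    case (Suc n)
    have "qpn (a * z) q (Suc n) * f z = qpn z q n * ((1 - a * (z * q ^ n)) * f (z * q ^ n))"
      using Suc by (simp add: qpoch_Suc mult_ac)
    also have "(1 - a * (z * q ^ n)) * f (z * q ^ n) = (1 - z * q ^ n) * f (z * q ^ n * q)"
      unfolding f_def by (rule phi11_shift[OF q az'])
    finally show ?case by (simp add: qpoch_Suc mult_ac)
  qed simp
  obtain C where C: "\<And>n m. norm (phi11_term q a (z * q ^ n) m) \<le> C * (norm z ^ m * norm q ^ (m choose 2))"
    using phi11_bound[OF assms] by blast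
  \<comment> \<open>Every term with \<open>m > 0\<close> carries \<open>(z * q ^ n) ^ m\<close>, so
    only the term \<open>m = 0\<close> survives in the limit.\<close>
  have "(\<lambda>n. f (z * q ^ n)) \<longlonglongrightarrow> (\<Sum>m. if m = 0 then 1 else 0)"
    unfolding f_def
  proof (rule tannery)
    show "norm (phi11_term q a (z * q ^ n) m) \<le> C * (norm z ^ m * norm q ^ (m choose 2))" for n m
      by (rule C)
    show "summable (\<lambda>m. C * (norm z ^ m * norm q ^ (m choose 2)))"
      using q by (intro summable_mult summable_power_choose_2) auto
    show "(\<lambda>n. phi11_term q a (z * q ^ n) m) \<longlonglongrightarrow> (if m = 0 then 1 else 0)" for m
    proof -
      have qn: "(\<lambda>n. q ^ n) \<longlonglongrightarrow> 0" by (rule LIMSEQ_power_zero[OF q])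
      have "(\<lambda>n. phi11_term q a (z * q ^ n) m) \<longlonglongrightarrow>
         qpn a q m * (-1) ^ m * q ^ (m choose 2) * (z * 0) ^ m / (qpn q q m * (\<Prod>j<m. 1 - a * (z * 0) * q ^ j))"
        unfolding phi11_term_def qpoch_def[of "a * _"] enat.case
        by (intro tendsto_intros qn) (use qpoch_finite_nonzero[OF q q] in simp)
      moreover have "qpn a q m * (-1) ^ m * q ^ (m choose 2) * (z * 0) ^ m / (qpn q q m * (\<Prod>j<m. 1 - a * (z * 0) * q ^ j))
          = (if m = 0 then 1 else 0)"
        by (auto simp: binomial_eq_0)
      ultimately show ?thesis by simp
    qed
  qed
  also have "(\<Sum>m. if m = 0 then 1 else 0) = (1::complex)"
    using sums_single[of 0 "\<lambda>_. 1::complex"] by (simp add: sums_iff)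
  finally have "(\<lambda>n. qpn z q n * f (z * q ^ n)) \<longlonglongrightarrow> qpoch z q \<infinity> * 1"
    by (intro tendsto_intros qpoch_tendsto q)
  moreover have "(\<lambda>n. qpn z q n * f (z * q ^ n)) \<longlonglongrightarrow> qpoch (a * z) q \<infinity> * f z"
    unfolding iter[symmetric] by (intro tendsto_intros qpoch_tendsto q)
  ultimately have "qpoch (a * z) q \<infinity> * f z = qpoch z q \<infinity>"
    using LIMSEQ_unique by fastforce
  then have "f z = qpoch z q \<infinity> / qpoch (a * z) q \<infinity>"
    using qpoch_infinite_nonzero[OF q az] by (simp add: field_simps)
  moreover have "summable (phi11_term q a z)"
    using phi11_summable[OF assms] by (rule summable_norm_cancel)
  ultimately show ?thesis
    by (auto simp: f_def sums_iff)
qed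

section \<open>Slater's Bailey pair E(3)\<close>

text \<open>
  The pair is relative to \<open>a = q\<close>; the last factor \<open>(q; q)_(n+r+1)\<close> absorbs the \<open>1 - q\<close> that appears
  in the denominator of the usual \<open>\<alpha>_r\<close> and the \<open>(aq; q)_(n+r)\<close> of the definition of a Bailey pair.
\<close>

definition bailey_term :: "complex \<Rightarrow> nat \<Rightarrow> nat \<Rightarrow> complex" where
  "bailey_term q n r = (-1) ^ r * q ^ (r ^ 2) * (1 - q ^ (2 * r + 1)) / (qpn q q (n - r) * qpn q q (n + r + 1))"

text \<open>Wilf-Zeilberger certificate for the recurrence \<open>(1 - q^(2n)) S_n = S_(n-1)\<close> of the row sums.\<close>

lemma bailey_telescope:
  assumes q: "norm q < 1" and "r < n"
  defines "G \<equiv> \<lambda>r. - ((-1) ^ r * q ^ (r ^ 2 + (n - r)) * (1 - q ^ (2 * r)) / (qpn q q (n - r) * qpn q q (n + r)))"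
  shows "(1 - q ^ (2 * n)) * bailey_term q n r - bailey_term q (n - 1) r = G (Suc r) - G r"
proof -
  \<comment> \<open>This removes all truncated differences, and everything becomes rational in
    \<open>q\<close>, \<open>x = q ^ r\<close> and \<open>y = q ^ k\<close>, up to the common factor
    \<open>N\<close>.\<close>
  obtain k where n: "n = Suc (r + k)"
    using assms(2) less_imp_Suc_add by blast
  have ne: "q * q ^ j \<noteq> 1" for j
    using mult_power_neq_1[OF q q] .
  have nz: "qpn q q j \<noteq> 0" for j
    using qpoch_finite_nonzero[OF q q] .
  define x y P R N where "x = q ^ r" "y = q ^ k" "P = qpn q q k" "R = qpn q q (2 * r + k + 1)"
    and N: "N = (-1) ^ r * q ^ (r ^ 2)"
  note defs = this
  have [simp]: "P \<noteq> 0" "R \<noteq> 0" using nz by (auto simp: defs)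
  have ny: "1 - q * y \<noteq> 0" using ne[of k] by (simp add: defs)
  have nxy: "1 - q * (q * x^2 * y) \<noteq> 0"
    using ne[of "Suc (2 * r + k)"] by (simp add: defs power_add power2_eq_square power_mult mult_ac flip: power_mult_distrib)
  have e: "2 * r + k + 1 + 1 = Suc (2 * r + k + 1)" "n - r = Suc k" "n + r + 1 = Suc (2 * r + k + 1)" "n + r = 2 * r + k + 1"
     "n - 1 - r = k" "n - 1 + r + 1 = 2 * r + k + 1" "n - Suc r = k" "n + Suc r = Suc (2 * r + k + 1)"
    by (auto simp: n)
  have p: "q ^ (2 * n) = (q * x * y)^2" "q ^ (2 * r + 1) = q * x^2" "q ^ (2 * Suc r) = (q * x)^2"
      "q ^ (2 * r) = x^2" "q ^ (2 * r + k + 1) = q * x^2 * y"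
      "q ^ ((Suc r)\<^sup>2 + k) = q ^ (r ^ 2) * q * x^2 * y"
      "q ^ (r\<^sup>2 + Suc k) = q ^ (r ^ 2) * q * y"
    by (simp_all add: n defs power_add mult_2 mult_2_right power2_eq_square algebra_simps)
  have b1: "bailey_term q n r = N * (1 - q * x^2) / (P * (1 - q * y) * (R * (1 - q * (q * x^2 * y))))"
    unfolding bailey_term_def e qpoch_Suc p defs(3,4)[symmetric] N[symmetric] by (simp only: defs(2))
  have b2: "bailey_term q (n - 1) r = N * (1 - q * x^2) / (P * R)"
    unfolding bailey_term_def e qpoch_Suc p defs(3,4)[symmetric] N[symmetric] by (simp only: defs(2))
  have g1: "G (Suc r) = N * q * x^2 * y * (1 - (q * x)^2) / (P * (R * (1 - q * (q * x^2 * y))))"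
    unfolding G_def e qpoch_Suc p defs(3,4)[symmetric] power_Suc[of "-1"] N by (simp add: mult_ac)
  have g2: "G r = - (N * q * y * (1 - x^2) / (P * (1 - q * y) * R))"
    unfolding G_def e qpoch_Suc p defs(3,4)[symmetric] N defs(2)[symmetric] by (simp add: mult_ac)
  define A B where A: "A = 1 - q * y" and B: "B = 1 - q * (q * x^2 * y)"
  have [simp]: "A \<noteq> 0" "B \<noteq> 0"
    using ny nxy by (simp_all add: A B)
  \<comment> \<open>\<open>A\<close> and \<open>B\<close> are the two denominator factors of row
    \<open>n\<close> that row \<open>n - 1\<close> does not have; clearing them leaves this
    identity.\<close>
  have poly: "(1 - (q * x * y)^2) * (1 - q * x^2) - (1 - q * x^2) * (A * B)
      = q * x^2 * y * (1 - (q * x)^2) * A + q * y * (1 - x^2) * B"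
    by (simp add: A B power2_eq_square algebra_simps)
  have "(1 - q ^ (2 * n)) * bailey_term q n r - bailey_term q (n - 1) r
      = N / (P * R * A * B) * ((1 - (q * x * y)^2) * (1 - q * x^2) - (1 - q * x^2) * (A * B))"
    unfolding b1 b2 p(1) A[symmetric] B[symmetric] by (simp add: divide_simps; simp add: algebra_simps)
  also have "\<dots> = G (Suc r) - G r"
    unfolding poly g1 g2 A[symmetric] B[symmetric] by (simp add: divide_simps; simp add: algebra_simps)
  finally show ?thesis .
qed

text \<open>Summing the certificate over \<open>r \<le> n\<close> leaves only
  \<open>G (Suc n)\<close>, which is minus \<open>1 - q ^ (2 * Suc n)\<close> times the top term of
  row \<open>Suc n\<close>. Moving it across completes that row and gives the recurrence for the row
  sums.\<close>

theorem bailey_pair: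
  assumes q: "norm q < 1"
  shows "(\<Sum>r\<le>n. bailey_term q n r) = 1 / qpn (q ^ 2) (q ^ 2) n"
proof (induction n)
  case 0
  show ?case
    using mult_power_neq_1[OF q q, of 0] by (simp add: bailey_term_def qpoch_Suc[of _ _ 0, simplified])
next
  case (Suc n)
  define G where "G = (\<lambda>r. - ((-1) ^ r * q ^ (r ^ 2 + (Suc n - r)) * (1 - q ^ (2 * r)) / (qpn q q (Suc n - r) * qpn q q (Suc n + r))))"
  have nz: "qpn q q j \<noteq> 0" for j
    using qpoch_finite_nonzero[OF q q] .
  have n2: "1 - q ^ (2 * Suc n) \<noteq> 0"
    using mult_power_neq_1[OF q q, of "2 * n + 1"] by simp
  have "(\<Sum>r\<le>n. (1 - q ^ (2 * Suc n)) * bailey_term q (Suc n) r - bailey_term q n r) = (\<Sum>r<Suc n. G (Suc r) - G r)"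
    unfolding lessThan_Suc_atMost G_def by (intro sum.cong refl) (use bailey_telescope[OF q, of _ "Suc n"] in auto)
  also have "\<dots> = G (Suc n)"
    by (subst sum_lessThan_telescope) (simp add: G_def)
  also have "\<dots> = - (1 - q ^ (2 * Suc n)) * bailey_term q (Suc n) (Suc n)"
  proof -
    define m where "m = Suc n + Suc n"
    have m: "2 * Suc n = m" by (simp add: m_def)
    have "1 - q * q ^ m \<noteq> 0"
      using mult_power_neq_1[OF q q, of m] by simp
    then show ?thesis
      using nz[of m] unfolding G_def bailey_term_def m m_def[symmetric] Suc_eq_plus1[symmetric] qpoch_Suc
      by simp (simp add: field_simps)
  qed
  finally have *: "(\<Sum>r\<le>n. (1 - q ^ (2 * Suc n)) * bailey_term q (Suc n) r - bailey_term q n r)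
      = - (1 - q ^ (2 * Suc n)) * bailey_term q (Suc n) (Suc n)" .
  have "(1 - q ^ (2 * Suc n)) * (\<Sum>r\<le>n. bailey_term q (Suc n) r) - (\<Sum>r\<le>n. bailey_term q n r)
      = - (1 - q ^ (2 * Suc n)) * bailey_term q (Suc n) (Suc n)"
    using * by (simp only: sum_subtractf sum_distrib_left)
  then have "(1 - q ^ (2 * Suc n)) * (\<Sum>r\<le>Suc n. bailey_term q (Suc n) r) = (\<Sum>r\<le>n. bailey_term q n r)"
    by (simp only: sum.atMost_Suc distrib_left) (metis add_uminus_conv_diff diff_add_cancel diff_eq_eq minus_mult_left uminus_add_conv_diff add.commute)
  then have "(\<Sum>r\<le>Suc n. bailey_term q (Suc n) r) = 1 / qpn (q\<^sup>2) (q\<^sup>2) n / (1 - q ^ (2 * Suc n))"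
    using n2 unfolding Suc by (metis nonzero_mult_div_cancel_left)
  moreover have "q\<^sup>2 * (q\<^sup>2) ^ n = q ^ (2 * Suc n)"
    by (metis power_Suc power_mult)
  ultimately show ?case
    unfolding qpoch_Suc by (simp only: divide_divide_eq_left)
qed

section \<open>The Jacobi triple product\<close>

text \<open>
  With \<open>x y = q\<close> this is \<open>y^k q^(k(k-1)/2)\<close> for all integers \<open>k\<close>, written without negative powers
  so that \<open>q = 0\<close> need not be treated separately. The reciprocals of \<open>(q; q)_j\<close> are extended by \<open>0\<close> to negative \<open>j\<close>, so that
  the finite sums can be shifted freely.
\<close>

definition theta_coeff :: "complex \<Rightarrow> complex \<Rightarrow> complex \<Rightarrow> int \<Rightarrow> complex" where
  "theta_coeff q x y k = (if k \<ge> 0 then y ^ nat k * q ^ (nat k choose 2)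
                          else x ^ nat (- k) * q ^ (nat (- k) choose 2))"

definition inv_qfact :: "complex \<Rightarrow> int \<Rightarrow> complex" where
  "inv_qfact q j = (if j \<ge> 0 then 1 / qpn q q (nat j) else 0)"

text \<open>At \<open>j = 0\<close> the factor \<open>1 - q ^ 0\<close> matches the value 0 given to
  negative arguments, so the relation has no exceptional case.\<close>

lemma inv_qfact_pred:
  assumes q: "norm q < 1"
  shows "inv_qfact q (int j - 1) = (1 - q ^ j) * inv_qfact q (int j)"
proof (cases j)
  case (Suc i)
  have "qpn q q (Suc i) \<noteq> 0"
    using qpoch_finite_nonzero[OF q q] .
  then show ?thesis
    by (simp add: inv_qfact_def Suc qpoch_Suc nat_add_distrib)
qed (simp add: inv_qfact_def)

lemma inv_qfact_pred2:
  assumes q: "norm q < 1"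
  shows "inv_qfact q (int j - 2) = (1 - q ^ (j - 1)) * (1 - q ^ j) * inv_qfact q (int j)"
proof (cases j)
  case (Suc i)
  then show ?thesis
    using inv_qfact_pred[OF q, of i] inv_qfact_pred[OF q, of j] by (simp add: mult_ac)
qed (simp add: inv_qfact_def)

text \<open>The q-Pascal rule applied twice, from row \<open>2 n\<close> to row
  \<open>2 n + 2\<close> of the q-binomial triangle. Expressing the lowered arguments through
  \<open>u\<close> and \<open>v\<close> reduces it to a polynomial identity in powers of
  \<open>q\<close>.\<close>

lemma inv_qfact_step:
  assumes q: "norm q < 1" and "u + v = 2 * n + 2"
  shows "(1 - q ^ (2 * n + 1)) * (1 - q ^ (2 * n + 2)) * (inv_qfact q u * inv_qfact q v)
       = (1 + q ^ (2 * n + 1)) * (inv_qfact q (int u - 1) * inv_qfact q (int v - 1))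
         + q ^ v * (inv_qfact q (int u - 2) * inv_qfact q v) + q ^ u * (inv_qfact q u * inv_qfact q (int v - 2))"
proof -
  have "(1 - q ^ (2 * n + 1)) * (1 - q ^ (2 * n + 2)) =
     (1 + q ^ (2 * n + 1)) * ((1 - q ^ u) * (1 - q ^ v))
     + q ^ v * ((1 - q ^ (u - 1)) * (1 - q ^ u)) + q ^ u * ((1 - q ^ (v - 1)) * (1 - q ^ v))"
  \<comment> \<open>Here \<open>u - 1\<close> or \<open>v - 1\<close> is truncated, but the terms
    concerned carry the factor \<open>1 - q ^ 0 = 0\<close>.\<close>
  proof (cases "u = 0 \<or> v = 0")
    case True
    then show ?thesis using assms(2) by auto
  next
    case False
    then obtain i j where ij: "u = Suc i" "v = Suc j"
      by (metis not0_implies_Suc)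
    then have "2 * n = i + j" using assms(2) by simp
    then show ?thesis by (simp add: ij power_add) (simp add: algebra_simps)
  qed
  then show ?thesis
    unfolding inv_qfact_pred[OF q] inv_qfact_pred2[OF q]
    by (simp only: distrib_right distrib_left mult_ac)
qed

lemma theta_coeff_uminus: "theta_coeff q x y (- k) = theta_coeff q y x k"
  by (auto simp: theta_coeff_def)

text \<open>Formally \<open>y^k q^(k(k-1)/2)\<close> satisfies
  \<open>x a_(k+1) = q^(k+1) a_k\<close>; the extra \<open>q ^ n\<close> makes the exponent
  nonnegative, so that the relation holds at \<open>q = 0\<close> too.\<close>

lemma theta_coeff_Suc:
  assumes "x * y = q" "k \<ge> - int n - 1"
  shows "q ^ n * x * theta_coeff q x y (k + 1) = q ^ nat (int n + k + 1) * theta_coeff q x y k"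
proof -
  consider "k \<ge> 0" | "k = -1" | m where "k = - int m - 2"
  proof -
    have "k \<ge> 0 \<or> k = -1 \<or> k = - int (nat (- k - 2)) - 2" by linarith
    then show ?thesis using that by blast
  qed
  then show ?thesis
  proof cases
    case 1
    then obtain m where k: "k = int m" by (metis nonneg_int_cases)
    have "nat (int m + 1) = Suc m" "nat (int n + int m + 1) = n + m + 1" by auto
    then show ?thesis using assms(1)[symmetric]
      by (simp add: theta_coeff_def k choose_2_Suc power_add power_mult_distrib mult_ac)
  next
    case 2
    then show ?thesis by (simp add: theta_coeff_def binomial_eq_0)
  next
    case (3 m)
    have e: "nat (- (k + 1)) = Suc m" "nat (- k) = Suc (Suc m)" "nat (int n + k + 1) = n - Suc m"
      using 3 by auto
    have "Suc m \<le> n" using assms(2) 3 by simp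
    then have qn: "q ^ n = q ^ (n - Suc m) * q ^ Suc m" by (metis le_add_diff_inverse2 power_add)
    have "\<not> 0 \<le> k + 1" "\<not> 0 \<le> k" using 3 by auto
    then show ?thesis
      unfolding theta_coeff_def e qn choose_2_Suc[of "Suc m"] by (simp add: power_add mult_ac)
  qed
qed

lemma theta_coeff_pred:
  assumes "x * y = q" "k \<le> int n + 1"
  shows "q ^ n * y * theta_coeff q x y (k - 1) = q ^ nat (int n - k + 1) * theta_coeff q x y k"
  using theta_coeff_Suc[of y x q n "- k"] assms
  by (simp add: mult.commute[of y] flip: theta_coeff_uminus[of q x y])

text \<open>From \<open>n\<close> to \<open>n + 1\<close> the right side gains
  \<open>(1 + x q^n)(1 + y q^n) = 1 + q^(2n+1) + x q^n + y q^n\<close>. The last two summands shift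
  the index \<open>k\<close> by one, and the three resulting sums combine by the q-binomial
  recurrence.\<close>

theorem finite_jacobi_triple_product:
  assumes q: "norm q < 1" and xy: "x * y = q"
  shows "qpn q q (2 * n) * (\<Sum>k = - int n..int n. theta_coeff q x y k * (inv_qfact q (int n - k) * inv_qfact q (int n + k)))
       = qpn (- x) q n * qpn (- y) q n"
proof (induction n)
  case 0
  show ?case by (simp add: theta_coeff_def inv_qfact_def binomial_eq_0)
next
  case (Suc n)
  define a where "a = theta_coeff q x y"
  define c where "c = (\<lambda>n k. inv_qfact q (int n - k) * inv_qfact q (int n + k))"
  \<comment> \<open>The range of row \<open>n + 1\<close>. Since \<open>c n k\<close> vanishes for
    \<open>\<bar>k\<bar> > n\<close>, the sum for row \<open>n\<close> and both of its shifts extend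
    to it.\<close>
  define I where "I = {- int n - 1..int n + 1}"
  have c0: "c n k = 0" if "\<bar>k\<bar> > int n" for k
    using that by (auto simp: c_def inv_qfact_def)
  define T where "T = (\<Sum>k = - int n..int n. a k * c n k)"
  have T: "T = (\<Sum>k\<in>I. a k * c n k)"
    unfolding T_def I_def by (rule sum.mono_neutral_left) (auto simp: c0)
  have "q ^ n * x * T = (\<Sum>k = - int n - 1..int n - 1. q ^ n * x * a (k + 1) * c n (k + 1))"
    unfolding T_def sum_distrib_left
    by (rule sum.reindex_bij_witness[of _ "\<lambda>k. k + 1" "\<lambda>k. k - 1"]) auto
  also have "\<dots> = (\<Sum>k = - int n - 1..int n - 1. q ^ nat (int n + k + 1) * a k * c n (k + 1))"
    unfolding a_def by (intro sum.cong refl) (simp add: theta_coeff_Suc[OF xy])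
  also have "\<dots> = (\<Sum>k\<in>I. q ^ nat (int n + k + 1) * a k * c n (k + 1))"
    unfolding I_def by (rule sum.mono_neutral_left) (auto simp: c0)
  finally have Tx: "q ^ n * x * T = (\<Sum>k\<in>I. q ^ nat (int n + k + 1) * a k * c n (k + 1))" .
  have "q ^ n * y * T = (\<Sum>k = - int n + 1..int n + 1. q ^ n * y * a (k - 1) * c n (k - 1))"
    unfolding T_def sum_distrib_left
    by (rule sum.reindex_bij_witness[of _ "\<lambda>k. k - 1" "\<lambda>k. k + 1"]) auto
  also have "\<dots> = (\<Sum>k = - int n + 1..int n + 1. q ^ nat (int n - k + 1) * a k * c n (k - 1))"
    unfolding a_def by (intro sum.cong refl) (simp add: theta_coeff_pred[OF xy])
  also have "\<dots> = (\<Sum>k\<in>I. q ^ nat (int n - k + 1) * a k * c n (k - 1))"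
    unfolding I_def by (rule sum.mono_neutral_left) (auto simp: c0)
  finally have Ty: "q ^ n * y * T = (\<Sum>k\<in>I. q ^ nat (int n - k + 1) * a k * c n (k - 1))" .
  have step: "(1 - q ^ (2 * n + 1)) * (1 - q ^ (2 * n + 2)) * c (Suc n) k
      = (1 + q ^ (2 * n + 1)) * c n k + q ^ nat (int n + k + 1) * c n (k + 1)
        + q ^ nat (int n - k + 1) * c n (k - 1)" if "k \<in> I" for k
  proof -
    define u where "u = nat (int n - k + 1)"
    define v where "v = nat (int n + k + 1)"
    have uv: "int u = int n - k + 1" "int v = int n + k + 1"
      using that by (auto simp: u_def v_def I_def)
    then have "u + v = 2 * n + 2" by linarith
    from inv_qfact_step[OF q this] show ?thesis
      unfolding u_def[symmetric] v_def[symmetric] c_def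
      by (simp add: uv algebra_simps)
  qed
  have "(1 - q ^ (2 * n + 1)) * (1 - q ^ (2 * n + 2)) * (\<Sum>k\<in>I. a k * c (Suc n) k)
      = (\<Sum>k\<in>I. a k * ((1 - q ^ (2 * n + 1)) * (1 - q ^ (2 * n + 2)) * c (Suc n) k))"
    unfolding sum_distrib_left by (intro sum.cong refl) (simp only: mult_ac)
  also have "\<dots> = (\<Sum>k\<in>I. (1 + q ^ (2 * n + 1)) * (a k * c n k) + q ^ nat (int n + k + 1) * a k * c n (k + 1)
        + q ^ nat (int n - k + 1) * a k * c n (k - 1))"
    by (intro sum.cong refl, subst step) (simp_all only: distrib_left mult_ac)
  also have "\<dots> = (1 + q ^ (2 * n + 1)) * T + q ^ n * x * T + q ^ n * y * T"
    unfolding Tx Ty by (simp only: T sum.distrib sum_distrib_left)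
  also have "\<dots> = (1 + x * q ^ n) * (1 + y * q ^ n) * T"
    using xy[symmetric] by (simp add: power_add mult_2 mult_2_right algebra_simps)
  finally have "qpn q q (2 * n) * ((1 - q ^ (2 * n + 1)) * (1 - q ^ (2 * n + 2)) * (\<Sum>k\<in>I. a k * c (Suc n) k))
      = (1 + x * q ^ n) * (1 + y * q ^ n) * (qpn q q (2 * n) * T)"
    by (simp add: mult_ac)
  also have "qpn q q (2 * n) * T = qpn (- x) q n * qpn (- y) q n"
    using Suc by (simp add: T_def a_def c_def)
  finally have "qpn q q (2 * Suc n) * (\<Sum>k\<in>I. a k * c (Suc n) k) = qpn (- x) q (Suc n) * qpn (- y) q (Suc n)"
    by (simp add: qpoch_Suc mult_ac)
  moreover have "I = {- int (Suc n)..int (Suc n)}"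
    by (auto simp: I_def)
  ultimately show ?case
    by (simp only: a_def c_def)
qed

text \<open>The expression is the q-binomial coefficient of \<open>2 n\<close> over
  \<open>n + m\<close>; each of its three symbols tends to
  \<open>(q; q)_\<infinity>\<close>.\<close>

lemma gauss_coeff_tendsto:
  assumes q: "norm q < 1"
  shows "(\<lambda>n. qpn q q (2 * n) * (inv_qfact q (int n - int m) * inv_qfact q (int n + int m))) \<longlonglongrightarrow> 1 / qpoch q q \<infinity>"
proof -
  have nz: "qpoch q q \<infinity> \<noteq> 0"
    using qpoch_infinite_nonzero_unit_disc[OF q q] .
  have 2: "(\<lambda>n. qpn q q (2 * n)) \<longlonglongrightarrow> qpoch q q \<infinity>"
    by (rule filterlim_compose[OF qpoch_tendsto[OF q]]) (intro filterlim_subseq, simp add: strict_mono_def)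
  have i: "(\<lambda>n. 1 / qpn q q n) \<longlonglongrightarrow> 1 / qpoch q q \<infinity>"
    by (intro tendsto_intros qpoch_tendsto q nz)
  have "(\<lambda>n. inv_qfact q (int n - int m)) \<longlonglongrightarrow> 1 / qpoch q q \<infinity>"
    by (rule LIMSEQ_offset[of _ m]) (simp add: inv_qfact_def i)
  moreover have "(\<lambda>n. inv_qfact q (int n + int m)) \<longlonglongrightarrow> 1 / qpoch q q \<infinity>"
    using LIMSEQ_ignore_initial_segment[OF i, of m] by (simp add: inv_qfact_def nat_add_distrib)
  ultimately have "(\<lambda>n. qpn q q (2 * n) * (inv_qfact q (int n - int m) * inv_qfact q (int n + int m))) \<longlonglongrightarrow> qpoch q q \<infinity> * (1 / qpoch q q \<infinity> * (1 / qpoch q q \<infinity>))"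
    by (intro tendsto_mult 2)
  then show ?thesis using nz by simp
qed

lemma gauss_coeff_sum_tendsto:
  fixes y :: complex
  assumes q: "norm q < 1"
  defines "E \<equiv> \<lambda>n m. qpn q q (2 * n) * (inv_qfact q (int n - int m) * inv_qfact q (int n + int m))"
  shows "summable (\<lambda>m. y ^ m * q ^ (m choose 2))"
    and "(\<lambda>n. \<Sum>m\<le>n. y ^ m * q ^ (m choose 2) * E n m) \<longlonglongrightarrow> (\<Sum>m. y ^ m * q ^ (m choose 2)) / qpoch q q \<infinity>"
proof -
  show s: "summable (\<lambda>m. y ^ m * q ^ (m choose 2))"
    using summable_power_choose_2[of "norm q" "norm y"] q
    by (intro summable_norm_cancel[of "\<lambda>m. y ^ m * q ^ (m choose 2)"]) (auto simp: norm_mult norm_power)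
  have qj: "q * q ^ j \<noteq> 1" for j
    using mult_power_neq_1[OF q q] .
  obtain A where A: "A > 0" "\<And>n. norm (qpn q q n) \<le> A"
    using qpoch_bounded[OF q] by blast
  obtain B where B: "B > 0" "\<And>n. norm (inverse (qpn q q n)) \<le> B"
    using inverse_qpoch_bounded[OF q qj] by blast
  have B': "norm (inv_qfact q j) \<le> B" for j
    using B by (auto simp: inv_qfact_def divide_inverse)
  have E: "norm (E n m) \<le> A * (B * B)" for n m
    unfolding E_def norm_mult using A B B' by (intro mult_mono) auto
  have lim: "(\<lambda>n. E n m) \<longlonglongrightarrow> 1 / qpoch q q \<infinity>" for m
    unfolding E_def by (rule gauss_coeff_tendsto[OF q])
  have "(\<lambda>n. \<Sum>m. y ^ m * q ^ (m choose 2) * E n m) \<longlonglongrightarrow> (\<Sum>m. y ^ m * q ^ (m choose 2) * (1 / qpoch q q \<infinity>))"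
  proof (rule tannery)
    show "(\<lambda>n. y ^ m * q ^ (m choose 2) * E n m) \<longlonglongrightarrow> y ^ m * q ^ (m choose 2) * (1 / qpoch q q \<infinity>)" for m
      by (intro tendsto_intros lim)
    show "summable (\<lambda>m. norm y ^ m * norm q ^ (m choose 2) * (A * (B * B)))"
      by (intro summable_mult2 summable_power_choose_2) (use q in auto)
    show "norm (y ^ m * q ^ (m choose 2) * E n m) \<le> norm y ^ m * norm q ^ (m choose 2) * (A * (B * B))" for n m
      unfolding norm_mult norm_power by (intro mult_left_mono E) auto
  qed
  also have "(\<Sum>m. y ^ m * q ^ (m choose 2) * (1 / qpoch q q \<infinity>)) = (\<Sum>m. y ^ m * q ^ (m choose 2)) / qpoch q q \<infinity>"
    using suminf_mult2[OF s, of "1 / qpoch q q \<infinity>"] by simp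
  \<comment> \<open>For \<open>m > n\<close> the coefficient \<open>E n m\<close> is 0, as
    \<open>inv_qfact\<close> is taken at a negative argument.\<close>
  also have "(\<lambda>n. \<Sum>m. y ^ m * q ^ (m choose 2) * E n m) = (\<lambda>n. \<Sum>m\<le>n. y ^ m * q ^ (m choose 2) * E n m)"
    by (intro ext suminf_finite) (auto simp: E_def inv_qfact_def)
  finally show "(\<lambda>n. \<Sum>m\<le>n. y ^ m * q ^ (m choose 2) * E n m) \<longlonglongrightarrow> (\<Sum>m. y ^ m * q ^ (m choose 2)) / qpoch q q \<infinity>" .
qed

text \<open>Limit of the finite form. The indices \<open>k = m\<close> and
  \<open>k = - m - 1\<close> are paired, which turns the bilateral series into one over the
  naturals.\<close>

theorem jacobi_triple_product:
  assumes q: "norm q < 1" and xy: "x * y = q"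
  shows "(\<lambda>m. y ^ m * q ^ (m choose 2) + x ^ Suc m * q ^ (Suc m choose 2)) sums
           (qpoch (- x) q \<infinity> * qpoch (- y) q \<infinity> * qpoch q q \<infinity>)"
proof -
  define E where "E = (\<lambda>n m. qpn q q (2 * n) * (inv_qfact q (int n - int m) * inv_qfact q (int n + int m)))"
  define f where "f = (\<lambda>(y::complex) m. y ^ m * q ^ (m choose 2))"
  have lim: "summable (f z)" "(\<lambda>n. \<Sum>m\<le>n. f z m * E n m) \<longlonglongrightarrow> suminf (f z) / qpoch q q \<infinity>" for z
    using gauss_coeff_sum_tendsto[OF q, of z] by (simp_all add: E_def f_def)
  have f0: "f z 0 = 1" for z by (simp add: f_def binomial_eq_0)
  have split: "qpn (- x) q n * qpn (- y) q n = (\<Sum>m\<le>n. f y m * E n m) + ((\<Sum>m\<le>n. f x m * E n m) - E n 0)" for n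
  proof -
    define t where "t = (\<lambda>k. qpn q q (2 * n) * (theta_coeff q x y k * (inv_qfact q (int n - k) * inv_qfact q (int n + k))))"
    have "qpn (- x) q n * qpn (- y) q n = (\<Sum>k = - int n..int n. t k)"
      by (simp add: t_def finite_jacobi_triple_product[OF assms, symmetric] sum_distrib_left)
    also have "{- int n..int n} = {0..int n} \<union> {- int n..-1}" by auto
    also have "sum t \<dots> = sum t {0..int n} + sum t {- int n..-1}"
      by (rule sum.union_disjoint) auto
    also have "sum t {0..int n} = (\<Sum>m\<le>n. f y m * E n m)"
      by (rule sum.reindex_bij_witness[of _ int nat]) (auto simp: t_def f_def E_def theta_coeff_def)
    also have "sum t {- int n..-1} = (\<Sum>m\<in>{1..n}. f x m * E n m)"
      by (rule sum.reindex_bij_witness[of _ "\<lambda>m. - int m" "\<lambda>k. nat (- k)"])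
         (auto simp: t_def f_def E_def theta_coeff_def)
    \<comment> \<open>The index 0 belongs to the other half; adding and subtracting it here lets one
      limit statement serve both halves.\<close>
    also have "\<dots> = (\<Sum>m\<le>n. f x m * E n m) - E n 0"
      using sum.atLeast_Suc_atMost[of 0 n "\<lambda>m. f x m * E n m"] by (simp add: f0 atLeast0AtMost)
    finally show ?thesis .
  qed
  have nz: "qpoch q q \<infinity> \<noteq> 0"
    using qpoch_infinite_nonzero_unit_disc[OF q q] .
  have "(\<lambda>n. E n 0) \<longlonglongrightarrow> 1 / qpoch q q \<infinity>"
    using gauss_coeff_tendsto[OF q, of 0] by (simp add: E_def)
  then have "(\<lambda>n. (\<Sum>m\<le>n. f y m * E n m) + ((\<Sum>m\<le>n. f x m * E n m) - E n 0)) \<longlonglongrightarrow>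
      suminf (f y) / qpoch q q \<infinity> + (suminf (f x) / qpoch q q \<infinity> - 1 / qpoch q q \<infinity>)"
    by (intro tendsto_intros lim)
  moreover have "(\<lambda>n. qpn (- x) q n * qpn (- y) q n) \<longlonglongrightarrow> qpoch (- x) q \<infinity> * qpoch (- y) q \<infinity>"
    by (intro tendsto_intros qpoch_tendsto q)
  ultimately have "qpoch (- x) q \<infinity> * qpoch (- y) q \<infinity> = suminf (f y) / qpoch q q \<infinity> + (suminf (f x) / qpoch q q \<infinity> - 1 / qpoch q q \<infinity>)"
    unfolding split by (intro LIMSEQ_unique)
  then have *: "qpoch (- x) q \<infinity> * qpoch (- y) q \<infinity> * qpoch q q \<infinity> = suminf (f y) + (suminf (f x) - f x 0)"
    using nz by (simp add: field_simps f0)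
  have "(\<lambda>m. f y m + f x (Suc m)) sums (suminf (f y) + (suminf (f x) - f x 0))"
    by (intro sums_add, unfold sums_Suc_iff) (auto intro!: summable_sums lim)
  then show ?thesis
    unfolding * by (simp add: f_def)
qed

section \<open>Generating functions by number of parts\<close>

text \<open>Fubini for a product of two absolutely convergent sums. Absolute summability is also
  concluded, so that products can be nested.\<close>

lemma has_sum_product:
  fixes f :: "'a \<Rightarrow> 'c :: {banach, real_normed_field}" and g :: "'b \<Rightarrow> 'c"
  assumes f: "(f has_sum a) A" "(\<lambda>x. norm (f x)) summable_on A" and g: "(g has_sum b) B" "(\<lambda>x. norm (g x)) summable_on B"
  shows "((\<lambda>(x, y). f x * g y) has_sum a * b) (A \<times> B)"
    and "(\<lambda>z. norm (case z of (x, y) \<Rightarrow> f x * g y)) summable_on (A \<times> B)"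
proof -
  have "(\<lambda>x. norm (infsum (\<lambda>y. norm (f x * g y)) B)) summable_on A"
    using summable_on_cmult_left[OF f(2), of "infsum (\<lambda>y. norm (g y)) B"]
    by (simp add: norm_mult infsum_cmult_right' abs_mult infsum_nonneg)
  moreover have "(\<lambda>y. norm (f x * g y)) summable_on B" for x
    using summable_on_cmult_right[OF g(2), of "norm (f x)"] by (simp add: norm_mult)
  ultimately show abs: "(\<lambda>z. norm (case z of (x, y) \<Rightarrow> f x * g y)) summable_on (A \<times> B)"
    by (subst Infinite_Sum.abs_summable_on_Sigma_iff) simp
  show "((\<lambda>(x, y). f x * g y) has_sum a * b) (A \<times> B)"
  proof (rule has_sum_SigmaI)
    show "((\<lambda>y. case (x, y) of (x, y) \<Rightarrow> f x * g y) has_sum f x * b) B" for x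
      using has_sum_cmult_right[OF g(1)] by simp
    show "((\<lambda>x. f x * b) has_sum a * b) A"
      by (rule has_sum_cmult_left[OF f(1)])
  qed (rule abs_summable_summable[OF abs])
qed

section \<open>Removing the smallest part of a partition in \<open>P4'\<close>\<close>

definition gap :: "nat \<Rightarrow> nat \<Rightarrow> bool" where
  "gap a b \<longleftrightarrow> a > b \<and> (odd a \<and> odd b \<longrightarrow> (a - b) mod 4 = 2) \<and>
     (even a \<and> even b \<longrightarrow> (a - b) mod 4 = 0) \<and> (even a \<noteq> even b \<longrightarrow> (a - b) mod 4 = 3)"

lemma sorted_wrt_greater_iff: "sorted_wrt (>) p \<longleftrightarrow> sorted_wrt (\<ge>) p \<and> distinct p" for p :: "nat list"
  by (induction p) (auto simp: order.strict_iff_order)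

lemma successively_gap_imp_sorted: "successively gap p \<Longrightarrow> sorted_wrt (>) p"
  by (subst successively_conv_sorted_wrt[symmetric]) (auto simp: transp_def gap_def intro: successively_mono)

text \<open>\<open>gap\<close> includes \<open>a > b\<close>, which makes strictness a condition on
  neighbours; in a decreasing list positivity need only be checked at the last part.\<close>

lemma P4'_iff:
  "p \<in> P4' \<longleftrightarrow> successively gap p \<and> (p \<noteq> [] \<longrightarrow> 0 < last p \<and> (last p mod 4 = 3 \<or> last p mod 4 = 0))"
proof -
  have 1: "is_strict_partition p \<longleftrightarrow> sorted_wrt (>) p \<and> (\<forall>x\<in>set p. 0 < x)"
    by (auto simp: is_strict_partition_def is_partition_def sorted_wrt_greater_iff)
  have 2: "(\<forall>x\<in>set p. 0 < x) \<longleftrightarrow> p \<noteq> [] \<longrightarrow> 0 < last p" if "sorted_wrt (>) p"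
    using that by (cases p rule: rev_cases) (auto simp: sorted_wrt_append dest: order.strict_trans)
  have 3: "sorted_wrt (>) p \<longleftrightarrow> (\<forall>i. Suc i < length p \<longrightarrow> p ! i > p ! Suc i)"
    by (subst successively_conv_sorted_wrt[symmetric]) (auto simp: transp_def successively_conv_nth)
  have 4: "successively gap p \<longleftrightarrow> (\<forall>i. Suc i < length p \<longrightarrow> p ! i > p ! Suc i) \<and> (\<forall>i. Suc i < length p \<longrightarrow>
        (odd (p ! i) \<and> odd (p ! Suc i) \<longrightarrow> (p ! i - p ! Suc i) mod 4 = 2) \<and>
        (even (p ! i) \<and> even (p ! Suc i) \<longrightarrow> (p ! i - p ! Suc i) mod 4 = 0) \<and>
        (even (p ! i) \<noteq> even (p ! Suc i) \<longrightarrow> (p ! i - p ! Suc i) mod 4 = 3))"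
    (is "_ \<longleftrightarrow> _ \<and> ?G")
    unfolding successively_conv_nth gap_def by (simp only: imp_conjR all_conj_distrib)
  have 5: "p \<in> P4' \<longleftrightarrow> is_strict_partition p \<and> ?G \<and> (p \<noteq> [] \<longrightarrow> last p mod 4 = 3 \<or> last p mod 4 = 0)"
    unfolding P4'_def mem_Collect_eq ..
  show ?thesis
    unfolding 4 5 1 3[symmetric] using 2 by argo
qed

lemma gap_add_even: "gap (a + 2 * d) (b + 2 * d) \<longleftrightarrow> gap a b"
  by (simp add: gap_def)

text \<open>\<open>gap\<close> is invariant under a common even shift, so \<open>k = 0\<close> may
  be taken: the new part is 3 or 4 and \<open>a\<close> is lifted by 2 or 4. The lift is chosen so
  that the gap above the new part becomes the old condition on a smallest part.\<close>

lemma gap_smallest_part: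
  "gap (a + 2 * (1 + of_bool e + 2 * k)) (3 + of_bool e + 4 * k) \<longleftrightarrow> 0 < a \<and> (a mod 4 = 3 \<or> a mod 4 = 0)"
proof (cases e)
  case True
  have "gap (a + 2 * (1 + of_bool e + 2 * k)) (3 + of_bool e + 4 * k) \<longleftrightarrow> gap (a + 4) 4"
  proof -
    have "a + 2 * (1 + of_bool e + 2 * k) = a + 4 + 2 * (2 * k)" "3 + of_bool e + 4 * k = 4 + 2 * (2 * k)"
      using True by simp_all
    then show ?thesis by (simp only: gap_add_even)
  qed
  also have "\<dots> \<longleftrightarrow> 0 < a \<and> (even a \<longrightarrow> a mod 4 = 0) \<and> (odd a \<longrightarrow> a mod 4 = 3)"
    by (auto simp: gap_def)
  also have "\<dots> \<longleftrightarrow> 0 < a \<and> (a mod 4 = 3 \<or> a mod 4 = 0)"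
    by presburger
  finally show ?thesis .
next
  case False
  have "gap (a + 2 * (1 + of_bool e + 2 * k)) (3 + of_bool e + 4 * k) \<longleftrightarrow> gap (a + 2) 3"
  proof -
    have "a + 2 * (1 + of_bool e + 2 * k) = a + 2 + 2 * (2 * k)" "3 + of_bool e + 4 * k = 3 + 2 * (2 * k)"
      using False by simp_all
    then show ?thesis by (simp only: gap_add_even)
  qed
  also have "\<dots> \<longleftrightarrow> 1 < a \<and> (even a \<longrightarrow> (a - 1) mod 4 = 3) \<and> (odd a \<longrightarrow> (a - 1) mod 4 = 2)"
    by (auto simp: gap_def)
  also have "\<dots> \<longleftrightarrow> 0 < a \<and> (a mod 4 = 3 \<or> a mod 4 = 0)"
  proof (cases a)
    case (Suc b)
    have "0 < b \<and> (odd b \<longrightarrow> b mod 4 = 3) \<and> (even b \<longrightarrow> b mod 4 = 2) \<longleftrightarrow> Suc b mod 4 = 3 \<or> Suc b mod 4 = 0"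
      by presburger
    then show ?thesis unfolding Suc by simp
  qed simp
  finally show ?thesis .
qed

definition add_smallest :: "nat list \<times> bool \<times> nat \<Rightarrow> nat list" where
  "add_smallest = (\<lambda>(p, e, k). map (\<lambda>t. t + 2 * (1 + of_bool e + 2 * k)) p @ [3 + of_bool e + 4 * k])"

definition P4'_len :: "nat \<Rightarrow> nat list set" where
  "P4'_len n = {p \<in> P4'. length p = n}"

lemma add_smallest_in_P4'_iff: "add_smallest (p, e, k) \<in> P4' \<longleftrightarrow> p \<in> P4'"
proof -
  define d where "d = 1 + of_bool e + 2 * k"
  define c where "c = 3 + of_bool e + 4 * k"
  have c: "c mod 4 = 3 \<or> c mod 4 = 0" "0 < c"
    unfolding c_def mod_mult_self2 by (cases e; simp)+
  have "gap (a + 2 * d) c \<longleftrightarrow> 0 < a \<and> (a mod 4 = 3 \<or> a mod 4 = 0)" for a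
    unfolding c_def d_def by (rule gap_smallest_part)
  then show ?thesis
    unfolding add_smallest_def split d_def[symmetric] c_def[symmetric] P4'_iff
    using c by (cases "p = []") (simp_all add: successively_append_iff successively_map gap_add_even last_map)
qed

lemma inj_add_smallest: "inj add_smallest"
proof (rule injI)
  fix x y assume xy: "add_smallest x = add_smallest y"
  obtain p e k p' e' k' where x: "x = (p, e, k)" and y: "y = (p', e', k')"
    using prod_cases3 by metis
  have "3 + of_bool e + 4 * k = 3 + of_bool e' + 4 * k'"
    using xy by (simp add: x y add_smallest_def)
  \<comment> \<open>The residue of the last part modulo 4 is 3 or 0 and determines
    \<open>e\<close>.\<close>
  then have ek: "e = e' \<and> k = k'"
    by (cases e; cases e'; simp; presburger)
  define d where "d = 2 * (1 + of_bool e + 2 * k)"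
  have "map (\<lambda>t. t + d) p = map (\<lambda>t. t + d) p'"
    using xy ek unfolding x y add_smallest_def split d_def by simp
  then have "p = p'"
    by (rule map_injective) (simp add: inj_def)
  with ek show "x = y" by (simp add: x y)
qed

lemma P4'_nonempty_cases:
  assumes "r \<in> P4'" "r \<noteq> []"
  obtains x where "r = add_smallest x"
proof -
  define b where "b = last r"
  define p where "p = butlast r"
  have r: "r = p @ [b]" using assms by (simp add: b_def p_def)
  have b: "b > 0" "b mod 4 = 3 \<or> b mod 4 = 0" and s: "successively gap r"
    using assms by (auto simp: P4'_iff b_def)
  define e k where "e = (b mod 4 = 0)" and "k = (b - 3) div 4"
  have be: "b = 3 + of_bool e + 4 * k"
    using b unfolding e_def k_def by (cases "b mod 4 = 0"; simp; presburger)
  define d where "d = 2 * (1 + of_bool e + 2 * k)"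
  \<comment> \<open>All other parts exceed \<open>b\<close>, hence also \<open>d\<close>, so
    lowering them by \<open>d\<close> is not truncated.\<close>
  have "d \<le> b" by (simp add: d_def be)
  have "sorted_wrt (>) r"
    using s by (rule successively_gap_imp_sorted)
  then have "\<forall>t\<in>set p. t > b"
    by (auto simp: r sorted_wrt_append)
  with \<open>d \<le> b\<close> have "map (\<lambda>t. t + d) (map (\<lambda>t. t - d) p) = p"
    by (auto intro!: map_idI simp: o_def)
  then have "r = add_smallest (map (\<lambda>t. t - d) p, e, k)"
    using r be by (simp only: add_smallest_def split d_def)
  then show ?thesis by (rule that)
qed

lemma bij_betw_add_smallest: "bij_betw add_smallest (P4'_len n \<times> UNIV) (P4'_len (Suc n))"
  unfolding bij_betw_def
proof
  show "inj_on add_smallest (P4'_len n \<times> UNIV)"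
    using inj_add_smallest by (rule inj_on_subset) simp
  have len: "length (add_smallest (p, e, k)) = Suc (length p)" for p e k
    by (simp add: add_smallest_def)
  show "add_smallest ` (P4'_len n \<times> UNIV) = P4'_len (Suc n)"
  proof (intro equalityI subsetI)
    fix r assume "r \<in> P4'_len (Suc n)"
    then have r: "r \<in> P4'" "length r = Suc n" by (auto simp: P4'_len_def)
    then obtain p e k where "r = add_smallest (p, e, k)"
      by (metis P4'_nonempty_cases list.size(3) nat.distinct(1) prod_cases3)
    then show "r \<in> add_smallest ` (P4'_len n \<times> UNIV)"
      using r by (auto simp: P4'_len_def add_smallest_in_P4'_iff len intro!: image_eqI[of _ _ "(p, e, k)"])
  qed (auto simp: P4'_len_def add_smallest_in_P4'_iff len)
qed

section \<open>Signed generating function for a fixed number of parts\<close>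

text \<open>The case \<open>s = -1\<close> is the signed sum; \<open>s = 1\<close> with \<open>norm q\<close> for \<open>q\<close> serves as its absolute majorant.\<close>

definition weight :: "'a :: {banach, real_normed_field} \<Rightarrow> 'a \<Rightarrow> nat list \<Rightarrow> 'a" where
  "weight s q p = s ^ num_odd_parts p * q ^ sum_list p"

lemma sum_list_map_add: "sum_list (map (\<lambda>t. t + d) p) = sum_list p + length p * d" for d :: nat
  by (induction p) simp_all

text \<open>The lift of the \<open>n\<close> old parts and the new part together add
  \<open>2 n + 3\<close> or \<open>4 n + 4\<close>, plus \<open>(4 n + 4) k\<close>. An even lift
  preserves parities, so the sign changes only through the new part.\<close>

lemma weight_add_smallest:
  assumes "length p = n"
  shows "weight s q (add_smallest (p, e, k)) = weight s q p * ((if e then q ^ (4 * n + 4) else s * q ^ (2 * n + 3)) * (q ^ (4 * n + 4)) ^ k)"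
proof -
  have "sum_list (add_smallest (p, e, k)) = sum_list p + n * (2 * (1 + of_bool e + 2 * k)) + (3 + of_bool e + 4 * k)"
    unfolding add_smallest_def split sum_list_append sum_list_map_add assms by simp
  also have "\<dots> = sum_list p + (if e then 4 * n + 4 else 2 * n + 3) + (4 * n + 4) * k"
    by (simp add: algebra_simps)
  finally have 1: "sum_list (add_smallest (p, e, k)) = sum_list p + (if e then 4 * n + 4 else 2 * n + 3) + (4 * n + 4) * k" .
  have pow: "q ^ (a + (if e then M else L) + M * k) = q ^ a * (if e then q ^ M else q ^ L) * (q ^ M) ^ k" for a L M
    by (simp add: power_add power_mult)
  have "odd (3 + of_bool e + 4 * k) \<longleftrightarrow> \<not> e" by (cases e) simp_all
  then have 2: "num_odd_parts (add_smallest (p, e, k)) = num_odd_parts p + of_bool (\<not> e)"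
    by (simp add: num_odd_parts_def add_smallest_def filter_map o_def)
  show ?thesis
    unfolding weight_def 1 2 pow power_add[of s] by (simp only: of_bool_def mult_ac split: if_splits) (simp add: mult_ac)
qed

definition gf_len :: "'a :: {banach, real_normed_field} \<Rightarrow> 'a \<Rightarrow> nat \<Rightarrow> 'a" where
  "gf_len s q n = (\<Prod>j<n. (s * q ^ (2 * j + 3) + q ^ (4 * j + 4)) / (1 - q ^ (4 * j + 4)))"

lemma has_sum_weight_len:
  fixes q s :: "'a :: {banach, real_normed_field}"
  assumes q: "norm q < 1"
  shows "(weight s q has_sum gf_len s q n) (P4'_len n) \<and> (\<lambda>p. norm (weight s q p)) summable_on P4'_len n"
proof (induction n)
  case 0
  have "P4'_len 0 = {[]}"
    by (auto simp: P4'_len_def P4'_iff)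
  then show ?case
    by (simp add: gf_len_def weight_def num_odd_parts_def has_sum_finiteI)
next
  case (Suc n)
  define f where "f = (\<lambda>e. if e then q ^ (4 * n + 4) else s * q ^ (2 * n + 3))"
  define g where "g = (\<lambda>k. (q ^ (4 * n + 4)) ^ k)"
  have x: "norm (q ^ (4 * n + 4)) < 1"
    using q by (simp add: norm_power power_less_one_iff del: power_Suc)
  have g_abs: "summable (\<lambda>k. norm (g k))"
    unfolding g_def norm_power[of "q ^ (4 * n + 4)"] using x by (intro summable_geometric) simp
  then have g: "(\<lambda>x. norm (g x)) summable_on UNIV" "(g has_sum 1 / (1 - q ^ (4 * n + 4))) UNIV"
    using norm_summable_imp_summable_on[of "\<lambda>k. norm (g k)"]
      norm_summable_imp_has_sum[OF g_abs, where S = "1 / (1 - q ^ (4 * n + 4))"] geometric_sums[OF x]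
    by (simp_all add: g_def del: power_Suc)
  have f: "(\<lambda>x. norm (f x)) summable_on UNIV" "(f has_sum (s * q ^ (2 * n + 3) + q ^ (4 * n + 4))) UNIV"
    by (auto intro!: summable_on_finite has_sum_finiteI simp: f_def UNIV_bool)
  \<comment> \<open>The sum over \<open>e\<close> gives the numerator and the geometric series over
    \<open>k\<close> the denominator of the next factor of \<open>gf_len\<close>.\<close>
  note fg = has_sum_product[OF f(2,1) g(2,1)]
  note wfg = has_sum_product[OF Suc[THEN conjunct1] Suc[THEN conjunct2] fg]
  have eq: "weight s q (add_smallest y) = (case y of (p, y) \<Rightarrow> weight s q p * (case y of (e, k) \<Rightarrow> f e * g k))"
    if "y \<in> P4'_len n \<times> UNIV" for y
    using that weight_add_smallest[of _ n s q] by (auto simp: P4'_len_def f_def g_def)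
  have "((\<lambda>y. weight s q (add_smallest y)) has_sum gf_len s q (Suc n)) (P4'_len n \<times> UNIV)"
    using wfg(1) by (subst has_sum_cong[OF eq]) (simp_all add: gf_len_def)
  moreover have "(\<lambda>y. norm (weight s q (add_smallest y))) summable_on (P4'_len n \<times> UNIV)"
    using wfg(2) by (subst summable_on_cong[OF arg_cong[OF eq, where f = norm]]) simp_all
  ultimately show ?case
    using has_sum_reindex_bij_betw[OF bij_betw_add_smallest, of "weight s q"]
      summable_on_reindex_bij_betw[OF bij_betw_add_smallest, of "\<lambda>p. norm (weight s q p)"]
    by simp
qed

lemma gf_len_nonneg:
  fixes x :: real
  assumes "0 \<le> x" "x < 1"
  shows "0 \<le> gf_len 1 x n"
  unfolding gf_len_def using assms
  by (intro prod_nonneg ballI divide_nonneg_nonneg add_nonneg_nonneg mult_nonneg_nonneg) (auto simp: power_le_one)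

text \<open>Ratio test: the factors of the product tend to 0.\<close>

lemma summable_gf_len:
  fixes x :: real
  assumes "0 \<le> x" "x < 1"
  shows "summable (gf_len 1 x)"
proof -
  define t where "t = (\<lambda>j. (x ^ (2 * j + 3) + x ^ (4 * j + 4)) / (1 - x ^ (4 * j + 4)))"
  have p0: "(\<lambda>j. x ^ (a * j + b)) \<longlonglongrightarrow> 0" if "a > 0" for a b
    by (rule filterlim_compose[OF LIMSEQ_power_zero]) (use assms that in \<open>auto intro!: filterlim_subseq simp: strict_mono_def\<close>)
  have "t \<longlonglongrightarrow> (0 + 0) / (1 - 0)"
    unfolding t_def by (intro tendsto_intros p0) auto
  then have "eventually (\<lambda>j. t j < 1 / 2) sequentially"
    by (intro order_tendstoD) auto
  then obtain N where N: "\<And>j. j \<ge> N \<Longrightarrow> t j < 1 / 2"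
    by (auto simp: eventually_sequentially)
  have t0: "t j \<ge> 0" for j
    using assms power_le_one[of x "4 * j + 4"] by (auto simp: t_def intro!: divide_nonneg_nonneg add_nonneg_nonneg)
  show ?thesis
  proof (rule summable_ratio_test[where c = "1 / 2" and N = N])
    fix n assume "n \<ge> N"
    have "gf_len 1 x (Suc n) = gf_len 1 x n * t n"
      by (simp add: gf_len_def t_def)
    moreover have "gf_len 1 x n \<ge> 0"
      by (rule gf_len_nonneg[OF assms])
    ultimately show "norm (gf_len 1 x (Suc n)) \<le> 1 / 2 * norm (gf_len 1 x n)"
      using t0[of n] N[OF \<open>n \<ge> N\<close>] mult_right_mono[of "t n" "1 / 2" "gf_len 1 x n"]
      by (simp add: abs_mult mult_ac)
  qed simp
qed

text \<open>The set is split by length. Absolute summability of the whole follows from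
  \<open>summable_gf_len\<close> at \<open>norm q\<close>, and summing each length separately then
  gives the value.\<close>

theorem has_sum_P4':
  fixes q :: complex
  assumes q: "norm q < 1"
  shows "((\<lambda>p. (-1) ^ num_odd_parts p * q ^ sum_list p) has_sum (\<Sum>n. gf_len (-1) q n)) P4'"
proof -
  define w where "w = weight (-1) q"
  have norm_w: "norm (w p) = weight 1 (norm q) p" for p
    by (simp add: w_def weight_def norm_mult norm_power)
  have bij: "bij_betw snd (Sigma UNIV P4'_len) P4'"
    by (rule bij_betwI[of _ _ _ "\<lambda>p. (length p, p)"]) (auto simp: P4'_len_def)
  have len: "(w has_sum gf_len (-1) q n) (P4'_len n)" "(\<lambda>p. norm (w p)) summable_on P4'_len n" for n
    using has_sum_weight_len[OF q, of "-1" n] by (simp_all add: w_def)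
  have inf: "infsum (\<lambda>p. norm (w p)) (P4'_len n) = gf_len 1 (norm q) n" for n
    using has_sum_weight_len[of "norm q" 1 n] q by (simp add: norm_w infsumI)
  have "(\<lambda>n. norm (gf_len 1 (norm q) n)) summable_on UNIV"
    using summable_gf_len[of "norm q"] gf_len_nonneg[of "norm q"] q
    by (subst summable_on_UNIV_nonneg_real_iff) auto
  then have "(\<lambda>z. norm (case z of (n, p) \<Rightarrow> w p)) summable_on Sigma UNIV P4'_len"
    by (subst Infinite_Sum.abs_summable_on_Sigma_iff) (simp only: split inf len(2) simp_thms ball_simps)
  then have summ: "(\<lambda>(n, p). w p) summable_on Sigma UNIV P4'_len"
    by (rule abs_summable_summable)
  then obtain S where S: "((\<lambda>(n, p). w p) has_sum S) (Sigma UNIV P4'_len)"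
    by (auto simp: summable_on_def)
  have "(gf_len (-1) q has_sum S) UNIV"
    using has_sum_SigmaD[OF S] len(1) by simp
  then have "S = (\<Sum>n. gf_len (-1) q n)"
    using has_sum_imp_sums sums_unique by blast
  moreover have "(w has_sum S) P4'"
    using S has_sum_reindex_bij_betw[OF bij, of w S] by (simp add: case_prod_unfold)
  ultimately show ?thesis
    by (simp add: w_def weight_def[abs_def])
qed

section \<open>The series and the product\<close>

lemma norm_power_less_1:
  fixes q :: complex
  assumes "norm q < 1" "k > 0"
  shows "norm (q ^ k) < 1"
  using assms by (simp add: norm_power power_less_one_iff)

text \<open>Each numerator factors as \<open>- q^(2n+3) (1 - q^(2n+1))\<close>, and the exponents
  \<open>2 j + 3\<close> for \<open>j < n\<close> add up to \<open>n^2 + 2 n\<close>.\<close>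

lemma gf_len_eq:
  assumes q: "norm q < 1"
  shows "gf_len (-1) q n = qpn q (q ^ 2) n * (-1) ^ n * q ^ (n ^ 2 + 2 * n) / qpn (q ^ 4) (q ^ 4) n"
proof (induction n)
  case 0
  show ?case by (simp add: gf_len_def)
next
  case (Suc n)
  have num: "- (q ^ (2 * n + 3)) + q ^ (4 * n + 4) = (1 - q * (q\<^sup>2) ^ n) * (- 1) * q ^ (2 * n + 3)"
    by (simp add: algebra_simps flip: power_mult power_add power_Suc)
  have den: "q ^ (4 * n + 4) = q ^ 4 * (q ^ 4) ^ n"
    by (simp add: power_add power_mult)
  have ex: "(Suc n)\<^sup>2 + 2 * Suc n = n ^ 2 + 2 * n + (2 * n + 3)"
    by (simp add: power2_eq_square)
  have "gf_len (-1) q (Suc n) = gf_len (-1) q n * ((- (q ^ (2 * n + 3)) + q ^ (4 * n + 4)) / (1 - q ^ (4 * n + 4)))"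
    by (simp add: gf_len_def)
  also have "\<dots> = qpn q (q\<^sup>2) (Suc n) * (-1) ^ Suc n * q ^ ((Suc n)\<^sup>2 + 2 * Suc n) / qpn (q ^ 4) (q ^ 4) (Suc n)"
    unfolding Suc num unfolding den ex qpoch_Suc power_add[of q "n\<^sup>2 + 2 * n"] power_Suc[of "-1"] times_divide_times_eq
    by (simp only: mult_ac)
  finally show ?case .
qed

text \<open>Summand of the double series that arises when \<open>1 / (q^4; q^4)_n\<close> is
  expanded by the Bailey pair in base \<open>q ^ 2\<close>.\<close>

definition slater_term :: "complex \<Rightarrow> nat \<Rightarrow> nat \<Rightarrow> complex" where
  "slater_term q n r = qpn q (q ^ 2) n * (-1) ^ n * q ^ (n ^ 2 + 2 * n) * bailey_term (q ^ 2) n r"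

text \<open>With \<open>n = r + m\<close> the sum is a constant \<open>K\<close> times the
  \<open>1\<phi>1\<close> series in base \<open>q ^ 2\<close> at \<open>a = q^(2r+1)\<close>,
  \<open>z = q^(2r+3)\<close>.\<close>

lemma slater_term_inner:
  assumes q: "norm q < 1"
  shows "(\<lambda>m. slater_term q (r + m) r) sums
    (q ^ (3 * r ^ 2 + 2 * r) * (1 + q ^ (2 * r + 1)) * (qpoch q (q ^ 2) \<infinity> / qpoch (q ^ 2) (q ^ 2) \<infinity>))"
proof -
  define Q where "Q = q ^ 2"
  define a z where "a = q ^ (2 * r + 1)" and "z = q ^ (2 * r + 3)"
  define K where "K = q ^ (3 * r ^ 2 + 2 * r) * (1 - a ^ 2) * qpn q Q r / qpn Q Q (2 * r + 1)"
  have Q: "norm Q < 1" unfolding Q_def by (rule norm_power_less_1) (use q in auto)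
  have az_eq: "a * z = Q * Q ^ (2 * r + 1)"
    unfolding a_def z_def Q_def power_mult[symmetric] power_add[symmetric]
    by (rule arg_cong[of _ _ "power q"]) simp
  have "norm (a * z) < 1"
    unfolding a_def z_def power_add[symmetric] by (rule norm_power_less_1) (use q in auto)
  then have az: "a * z * Q ^ j \<noteq> 1" for j
    by (rule mult_power_neq_1[OF _ Q])
  have eq: "slater_term q (r + m) r = K * phi11_term Q a z m" for m
  proof -
    have e1: "(r + m)\<^sup>2 + 2 * (r + m) + 2 * r\<^sup>2 = 3 * r ^ 2 + 2 * r + (2 * (m choose 2) + (2 * r + 3) * m)"
    proof -
      have "2 * (m choose 2) + m = m ^ 2"
        by (induction m) (simp_all add: choose_2_Suc binomial_eq_0 power2_eq_square)
      then show ?thesis by (simp add: power2_eq_square algebra_simps)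
    qed
    have e2: "q ^ ((r + m)\<^sup>2 + 2 * (r + m)) * Q ^ (r ^ 2) = q ^ (3 * r ^ 2 + 2 * r) * (Q ^ (m choose 2) * z ^ m)"
      unfolding Q_def z_def power_mult[symmetric] power_add[symmetric] e1 ..
    have e3: "1 - Q ^ (2 * r + 1) = 1 - a ^ 2"
      unfolding Q_def a_def by (simp only: power_mult[symmetric] mult.commute)
    have e4: "qpn q Q (r + m) = qpn q Q r * qpn a Q m"
      by (simp add: qpoch_add a_def Q_def flip: power_mult)
    have e5: "r + m - r = m" "r + m + r + 1 = (2 * r + 1) + m" by auto
    have "slater_term q (r + m) r
        = qpn q Q (r + m) * ((-1) ^ (r + m) * (-1) ^ r) * (q ^ ((r + m)\<^sup>2 + 2 * (r + m)) * Q ^ (r ^ 2))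
          * (1 - Q ^ (2 * r + 1)) / (qpn Q Q m * (qpn Q Q (2 * r + 1) * qpn (a * z) Q m))"
      unfolding slater_term_def bailey_term_def Q_def[symmetric] e5 qpoch_add[of Q Q "2 * r + 1"] az_eq
      by (simp add: mult_ac)
    also have "(-1) ^ (r + m) * (-1) ^ r = (-1 :: complex) ^ m"
      by (simp add: power_add flip: power_mult_distrib)
    finally show ?thesis
      unfolding e2 e3 e4 K_def phi11_term_def times_divide_times_eq by (simp only: mult_ac)
  qed
  \<comment> \<open>The factor \<open>1 - a\<close> is isolated because \<open>K\<close> contains
    \<open>1 - a ^ 2\<close>; their quotient is the \<open>1 + a\<close> of the result.\<close>
  have s1: "qpoch q Q \<infinity> = qpn q Q r * ((1 - a) * qpoch z Q \<infinity>)"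
  proof -
    have "q * Q ^ r = a" "a * Q ^ 1 = z"
      by (simp_all add: a_def z_def Q_def numeral_3_eq_3 flip: power_mult power_Suc power_add)
    then show ?thesis
      using qpoch_infinite_split[OF Q, of q r] qpoch_infinite_split[OF Q, of a 1]
      by (simp add: qpoch_Suc[of _ _ 0, simplified])
  qed
  have s2: "qpoch Q Q \<infinity> = qpn Q Q (2 * r + 1) * qpoch (a * z) Q \<infinity>"
    using qpoch_infinite_split[OF Q, of Q "2 * r + 1"] by (simp add: az_eq)
  have "K * (qpoch z Q \<infinity> / qpoch (a * z) Q \<infinity>)
      = q ^ (3 * r ^ 2 + 2 * r) * (1 + a) * (qpoch q Q \<infinity> / qpoch Q Q \<infinity>)"
  proof -
    have "1 - a ^ 2 = (1 + a) * (1 - a)"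
      by (simp add: power2_eq_square algebra_simps)
    then show ?thesis
      unfolding s1 s2 K_def by (simp add: mult_ac)
  qed
  moreover have "(\<lambda>m. slater_term q (r + m) r) sums (K * (qpoch z Q \<infinity> / qpoch (a * z) Q \<infinity>))"
    unfolding eq by (intro sums_mult phi11_sum Q az)
  ultimately show ?thesis
    by (simp add: a_def Q_def)
qed

text \<open>Uniform in \<open>r\<close> and geometric in \<open>n = r + m\<close>, hence a product
  of two geometric series dominates the double series.\<close>

lemma slater_term_bound:
  assumes q: "norm q < 1"
  shows "\<exists>C. \<forall>n r. norm (slater_term q n r) \<le> C * norm q ^ n"
proof -
  define Q where "Q = q ^ 2"
  have Q: "norm Q < 1" unfolding Q_def by (rule norm_power_less_1) (use q in auto)
  have qj: "Q * Q ^ j \<noteq> 1" for j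
    using mult_power_neq_1[OF Q Q] .
  obtain A where A: "A > 0" "\<And>n. norm (qpn q Q n) \<le> A"
    using qpoch_bounded[OF Q] by blast
  obtain B where B: "B > 0" "\<And>n. norm (inverse (qpn Q Q n)) \<le> B"
    using inverse_qpoch_bounded[OF Q qj] by blast
  have "norm (slater_term q n r) \<le> A * 2 * (B * B) * norm q ^ n" for n r
  proof -
    have "norm (1 - Q ^ (2 * r + 1)) \<le> norm (1::complex) + norm (Q ^ (2 * r + 1))"
      by (rule norm_triangle_ineq4)
    also have "\<dots> \<le> 2"
      using Q power_le_one[of "norm Q" "2 * r + 1"] by (simp add: norm_power norm_mult)
    finally have 1: "norm (1 - Q ^ (2 * r + 1)) \<le> 2" .
    have "norm q ^ (n\<^sup>2 + 2 * n) * norm Q ^ (r ^ 2) \<le> norm q ^ n * 1"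
      using q Q by (intro mult_mono power_decreasing power_le_one) auto
    then have "norm (qpn q Q n) * norm (1 - Q ^ (2 * r + 1)) * (norm (inverse (qpn Q Q (n - r))) * norm (inverse (qpn Q Q (n + r + 1))))
        * (norm q ^ (n\<^sup>2 + 2 * n) * norm Q ^ (r ^ 2)) \<le> A * 2 * (B * B) * norm q ^ n"
      using A B 1 by (intro mult_mono) auto
    moreover have "norm (slater_term q n r) = norm (qpn q Q n) * norm (1 - Q ^ (2 * r + 1)) * (norm (inverse (qpn Q Q (n - r))) * norm (inverse (qpn Q Q (n + r + 1))))
        * (norm q ^ (n\<^sup>2 + 2 * n) * norm Q ^ (r ^ 2))"
      unfolding slater_term_def bailey_term_def Q_def[symmetric] divide_inverse inverse_mult_distrib
      by (simp only: norm_mult norm_power norm_minus_cancel norm_one power_one mult_1_left mult_ac)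
    ultimately show ?thesis by simp
  qed
  then show ?thesis by blast
qed

text \<open>The absolutely convergent double series is summed in two ways: over \<open>m\<close> for
  fixed \<open>r\<close> by the \<open>1\<phi>1\<close> formula, and over \<open>r \<le> n\<close>
  for fixed \<open>n\<close> by the Bailey pair.\<close>

lemma slater_double_sum:
  assumes q: "norm q < 1"
  shows "(\<lambda>n. qpn q (q ^ 2) n * (-1) ^ n * q ^ (n ^ 2 + 2 * n) / qpn (q ^ 4) (q ^ 4) n) sums
    ((\<Sum>r. q ^ (3 * r ^ 2 + 2 * r) * (1 + q ^ (2 * r + 1))) * (qpoch q (q ^ 2) \<infinity> / qpoch (q ^ 2) (q ^ 2) \<infinity>))"
proof -
  define x where "x = norm q"
  define f where "f = (\<lambda>(r, m). slater_term q (r + m) r)"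
  define g where "g = (\<lambda>r. q ^ (3 * r ^ 2 + 2 * r) * (1 + q ^ (2 * r + 1)) * (qpoch q (q ^ 2) \<infinity> / qpoch (q ^ 2) (q ^ 2) \<infinity>))"
  have x: "0 \<le> x" "x < 1" using q by (simp_all add: x_def)
  obtain C where C: "\<And>n r. norm (slater_term q n r) \<le> C * x ^ n"
    using slater_term_bound[OF q] by (auto simp: x_def)
  have geo: "((\<lambda>n. x ^ n) has_sum 1 / (1 - x)) UNIV" "(\<lambda>n. norm (x ^ n)) summable_on UNIV"
    using x sums_nonneg_imp_has_sum[OF geometric_sums[of x]]
    by (auto simp: norm_power summable_on_def)
  have "(\<lambda>z. C * (case z of (r, m) \<Rightarrow> x ^ r * x ^ m)) summable_on UNIV \<times> UNIV"
    using has_sum_product(1)[OF geo geo] by (intro summable_on_cmult_right) (auto simp: summable_on_def)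
  then have "(\<lambda>z. norm (f z)) summable_on UNIV \<times> UNIV"
    by (rule summable_on_comparison_test) (auto simp: f_def C simp flip: power_add)
  then have "f summable_on UNIV \<times> UNIV"
    by (rule abs_summable_summable)
  then obtain T where T: "(f has_sum T) (UNIV \<times> UNIV)"
    by (auto simp: summable_on_def)
  have inner: "((\<lambda>m. f (r, m)) has_sum g r) UNIV" for r
  proof (rule norm_summable_imp_has_sum)
    show "(\<lambda>m. f (r, m)) sums g r"
      unfolding f_def g_def split by (rule slater_term_inner[OF q])
    show "summable (\<lambda>m. norm (f (r, m)))"
    proof (rule summable_comparison_test')
      show "summable (\<lambda>m. C * x ^ r * x ^ m)"
        using x by (intro summable_mult summable_geometric) simp
      show "norm (norm (f (r, m))) \<le> C * x ^ r * x ^ m" for m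
        using C[of "r + m" r] by (simp add: f_def power_add mult_ac)
    qed
  qed
  have gT: "g sums T"
    by (rule has_sum_imp_sums, rule has_sum_SigmaD[OF T inner])
  have "bij_betw (\<lambda>(n, r). (r, n - r)) (Sigma UNIV (\<lambda>n::nat. {..n})) (UNIV \<times> UNIV)"
    by (rule bij_betwI[of _ _ _ "\<lambda>(r, m). (r + m, r)"]) auto
  from has_sum_reindex_bij_betw[OF this, of f T] T
  have "((\<lambda>z. f (case z of (n, r) \<Rightarrow> (r, n - r))) has_sum T) (Sigma UNIV (\<lambda>n. {..n}))"
    by simp
  then have "((\<lambda>n. \<Sum>r\<le>n. slater_term q n r) has_sum T) UNIV"
    by (rule has_sum_SigmaD) (auto intro!: has_sum_finiteI simp: f_def)
  then have "(\<lambda>n. \<Sum>r\<le>n. slater_term q n r) sums T"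
    by (rule has_sum_imp_sums)
  moreover have "(\<Sum>r\<le>n. slater_term q n r) = qpn q (q ^ 2) n * (-1) ^ n * q ^ (n ^ 2 + 2 * n) / qpn (q ^ 4) (q ^ 4) n" for n
  proof -
    have "norm (q ^ 2) < 1" by (rule norm_power_less_1) (use q in auto)
    then have "(\<Sum>r\<le>n. bailey_term (q ^ 2) n r) = 1 / qpn ((q ^ 2) ^ 2) ((q ^ 2) ^ 2) n"
      by (rule bailey_pair)
    moreover have "(q ^ 2) ^ 2 = q ^ 4" by (simp flip: power_mult)
    ultimately show ?thesis
      unfolding slater_term_def sum_distrib_left[symmetric] by simp
  qed
  ultimately have left: "(\<lambda>n. qpn q (q ^ 2) n * (-1) ^ n * q ^ (n ^ 2 + 2 * n) / qpn (q ^ 4) (q ^ 4) n) sums T"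
    by simp
  define c where "c = qpoch q (q ^ 2) \<infinity> / qpoch (q ^ 2) (q ^ 2) \<infinity>"
  have c: "c \<noteq> 0"
    using norm_power_less_1[OF q, of 2] qpoch_infinite_nonzero_unit_disc[of q "q ^ 2"] qpoch_infinite_nonzero_unit_disc[of "q ^ 2" "q ^ 2"] q
    by (simp add: c_def)
  \<comment> \<open>Division by the nonzero \<open>c\<close> yields convergence of the theta series
    itself.\<close>
  have "(\<lambda>r. q ^ (3 * r ^ 2 + 2 * r) * (1 + q ^ (2 * r + 1))) sums (T / c)"
    using sums_divide[OF gT, of c] c by (simp add: g_def flip: c_def)
  then have "(\<Sum>r. q ^ (3 * r ^ 2 + 2 * r) * (1 + q ^ (2 * r + 1))) = T / c"
    by (rule sums_unique[symmetric])
  then have "(\<Sum>r. q ^ (3 * r ^ 2 + 2 * r) * (1 + q ^ (2 * r + 1))) * c = T"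
    using c by simp
  with left show "(\<lambda>n. qpn q (q ^ 2) n * (-1) ^ n * q ^ (n ^ 2 + 2 * n) / qpn (q ^ 4) (q ^ 4) n) sums
      ((\<Sum>r. q ^ (3 * r ^ 2 + 2 * r) * (1 + q ^ (2 * r + 1))) * (qpoch q (q ^ 2) \<infinity> / qpoch (q ^ 2) (q ^ 2) \<infinity>))"
    unfolding c_def by simp
qed

section \<open>The theta series as a product, and dissection of the products\<close>

lemma theta_sums:
  assumes q: "norm q < 1"
  shows "(\<lambda>r. q ^ (3 * r ^ 2 + 2 * r) * (1 + q ^ (2 * r + 1))) sums
    (qpoch (- q) (q ^ 6) \<infinity> * qpoch (- (q ^ 5)) (q ^ 6) \<infinity> * qpoch (q ^ 6) (q ^ 6) \<infinity>)"
proof -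
  have *: "(q ^ 5) ^ r * (q ^ 6) ^ (r choose 2) + q ^ Suc r * (q ^ 6) ^ (Suc r choose 2)
      = q ^ (3 * r ^ 2 + 2 * r) * (1 + q ^ (2 * r + 1))" for r
  proof -
    have c: "2 * (r choose 2) + r = r ^ 2"
      by (induction r) (simp_all add: choose_2_Suc binomial_eq_0 power2_eq_square)
    have u: "5 * r + 6 * (r choose 2) = 3 * r ^ 2 + 2 * r"
      unfolding c[symmetric] by simp
    have v: "Suc r + 6 * (Suc r choose 2) = 3 * r ^ 2 + 2 * r + (2 * r + 1)"
      unfolding c[symmetric] choose_2_Suc by simp
    show ?thesis
      unfolding power_mult[symmetric] power_add[symmetric] distrib_left[of "q ^ _"] mult_1_right u v ..
  qed
  have "norm (q ^ 6) < 1" by (rule norm_power_less_1) (use q in auto)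
  \<comment> \<open>Base \<open>q ^ 6\<close> with \<open>x = q\<close> and
    \<open>y = q ^ 5\<close>: the indices \<open>k = r\<close> and \<open>k = - r - 1\<close> give
    the exponents \<open>3r^2 + 2r\<close> and \<open>3r^2 + 4r + 1\<close>.\<close>
  from jacobi_triple_product[OF this, of q "q ^ 5"] show ?thesis
    unfolding * by (simp flip: power_Suc)
qed

lemma product_side:
  assumes q: "norm q < 1"
  shows "qpoch (- q) (q ^ 6) \<infinity> * qpoch (- (q ^ 5)) (q ^ 6) \<infinity> * qpoch (q ^ 6) (q ^ 6) \<infinity>
           * (qpoch q (q ^ 2) \<infinity> / qpoch (q ^ 2) (q ^ 2) \<infinity>)
       = qpochs [q ^ 3, q ^ 9] (q ^ 12) \<infinity> / qpochs [q ^ 4, q ^ 8] (q ^ 12) \<infinity>"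
proof -
  define P where "P = (\<lambda>s i j. qpoch (s * q ^ i) (q ^ j) \<infinity>)"
  have lt: "norm (q ^ k) < 1" if "k > 0" for k
    using norm_power_less_1[OF q that] .
  have nz: "P s i j \<noteq> 0" if "i > 0" "j > 0" "norm s = 1" for s i j
    unfolding P_def by (rule qpoch_infinite_nonzero_unit_disc) (use that lt in \<open>auto simp: norm_mult\<close>)
  have dis2: "P s i j = P s i (2 * j) * P s (i + j) (2 * j)" if "j > 0" for s i j
    using qpoch_infinite_dissect[OF lt[OF that], of 2 "s * q ^ i"]
    by (simp add: P_def lessThan_Suc numeral_2_eq_2 power_add power_mult mult_ac)
  have dis3: "P s i j = P s i (3 * j) * P s (i + j) (3 * j) * P s (i + 2 * j) (3 * j)" if "j > 0" for s i j
    using qpoch_infinite_dissect[OF lt[OF that], of 3 "s * q ^ i"]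
    by (simp add: P_def lessThan_Suc numeral_3_eq_3 numeral_2_eq_2 power_add power_mult mult_ac)
  have pm: "P 1 i j * P (-1) i j = P 1 (2 * i) (2 * j)" if "j > 0" for i j
    using qpoch_infinite_mult_minus[OF lt[OF that], of "q ^ i"]
    by (simp add: P_def mult.commute flip: power_mult)
  have "P 1 1 2 * P (-1) 1 2 = P 1 2 4" "P (-1) 1 2 = P (-1) 1 6 * P (-1) 3 6 * P (-1) 5 6"
    "P 1 2 2 = P 1 2 4 * P 1 4 4" "P 1 4 4 = P 1 4 12 * P 1 8 12 * P 1 12 12"
    "P 1 3 6 = P 1 3 12 * P 1 9 12" "P 1 3 6 * P (-1) 3 6 = P 1 6 12"
    "P 1 6 6 = P 1 6 12 * P 1 12 12"
    using pm[of 2 1] dis3[of 2 "-1" 1] dis2[of 2 1 2] dis3[of 4 1 4] dis2[of 6 1 3] pm[of 6 3] dis2[of 6 1 6]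
    by (simp_all del: One_nat_def)
  note rel = this
  have ne: "P (-1) 3 6 \<noteq> 0" "P 1 2 4 \<noteq> 0" "P 1 4 12 \<noteq> 0" "P 1 8 12 \<noteq> 0" "P 1 12 12 \<noteq> 0"
    by (simp_all add: nz)
  \<comment> \<open>Multiplying by \<open>(-q^3; q^6)_\<infinity>\<close> supplies the missing odd
    class modulo 6, so that \<open>(-q; q^2)_\<infinity>\<close> appears and pairs with
    \<open>(q; q^2)_\<infinity>\<close>. Being nonzero, the factor is cancelled at the end.\<close>
  have "P (-1) 3 6 * (P (-1) 1 6 * P (-1) 5 6 * P 1 6 6 * (P 1 1 2 / P 1 2 2))
      = (P 1 1 2 * P (-1) 1 2) * P 1 6 6 / P 1 2 2"
    unfolding rel(2) by simp
  also have "\<dots> = P 1 6 12 / (P 1 4 12 * P 1 8 12)"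
    unfolding rel(1) rel(3,4,7) using ne by simp
  also have "\<dots> = P (-1) 3 6 * (P 1 3 12 * P 1 9 12 / (P 1 4 12 * P 1 8 12))"
    unfolding rel(6)[symmetric] rel(5) by simp
  finally have "P (-1) 1 6 * P (-1) 5 6 * P 1 6 6 * (P 1 1 2 / P 1 2 2) = P 1 3 12 * P 1 9 12 / (P 1 4 12 * P 1 8 12)"
    using ne(1) by (simp only: mult_cancel_left simp_thms)
  then show ?thesis
    by (simp add: P_def qpochs_def)
qed

theorem theorem3p7:
  fixes q :: complex
  assumes "norm q < 1"
  shows "((\<lambda>p. (-1) ^ num_odd_parts p * q ^ sum_list p) has_sum
            (\<Sum>n. qpoch q (q ^ 2) (enat n) * (-1) ^ n * q ^ (n ^ 2 + 2 * n)
                  / qpoch (q ^ 4) (q ^ 4) (enat n))) P4' \<and>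
         (\<lambda>n. qpoch q (q ^ 2) (enat n) * (-1) ^ n * q ^ (n ^ 2 + 2 * n)
                  / qpoch (q ^ 4) (q ^ 4) (enat n)) sums
            (qpochs [q ^ 3, q ^ 9] (q ^ 12) \<infinity> / qpochs [q ^ 4, q ^ 8] (q ^ 12) \<infinity>)"
proof
  show "((\<lambda>p. (-1) ^ num_odd_parts p * q ^ sum_list p) has_sum
          (\<Sum>n. qpn q (q ^ 2) n * (-1) ^ n * q ^ (n ^ 2 + 2 * n) / qpn (q ^ 4) (q ^ 4) n)) P4'"
    using has_sum_P4'[OF assms] unfolding gf_len_eq[OF assms] .
  show "(\<lambda>n. qpn q (q ^ 2) n * (-1) ^ n * q ^ (n ^ 2 + 2 * n) / qpn (q ^ 4) (q ^ 4) n) sums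
          (qpochs [q ^ 3, q ^ 9] (q ^ 12) \<infinity> / qpochs [q ^ 4, q ^ 8] (q ^ 12) \<infinity>)"
    using slater_double_sum[OF assms]
    unfolding sums_unique[OF theta_sums[OF assms], symmetric] product_side[OF assms] .
qed

end
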